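(* Let $q$ be an odd prime power, $t\ge5$, $s$ an integer with $1\le s\le2t-1$ and $\gcd(s,2t)=1$, and let $(m,h)\in\mathbb{F}_{q^t}\times\mathbb{F}_{q^{2t}}$ be an admissible pair for $(q,t,s)$. Then: (1) if $t$ is even, $$G^\circ_{\psi_{m,h,s}}=\left\{\begin{pmatrix}\alpha&0\\0&\alpha^{q^s}\end{pmatrix}:\alpha\in\mathbb{F}_{q^2}\right\};$$ (2) if $t$ is odd, $G^\circ_{\psi_{m,h,s}}$ is the set of all matrices $$\begin{pmatrix}\alpha&\xi\,\dfrac{m^R}{h^{q^s}+h^{q^{s(t-1)}}}\\[2mm]-\xi\,\mathrm{N}_{q^{2t}/q^t}(h)\left(m^{Rq^s+1}h^{q^s}+m^{q^{s(t-1)}(R+1)}h^{q^{s(t-1)}}\right)&\alpha\end{pmatrix}$$ with $\alpha\in\mathbb{F}_q$ and $\xi\in\mathbb{F}_{q^2}$ such that $\xi^{q^s}+\xi=0$, where $R=-\dfrac{q^{s(t+1)}-1}{q^{2s}-1}$. In particular, $I_R(\mathcal{C}_{\psi_{m,h,s}})$ is isomorphic to $\mathbb{F}_{q^2}$.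
   Context: Trace and norm: $\mathrm{Tr}_{q^{2t}/q^t}(x)=x+x^{q^t}$, $\mathrm{N}_{q^{2t}/q^t}(x)=x^{q^t+1}$. Put $\mathscr{P}^+_s=\{w^{q^s+1}: w\in\ker\mathrm{Tr}_{q^{2t}/q^t}\}$ and $\mathscr{P}^-_s=\{w^{q^s-1}: w\in\ker\mathrm{Tr}_{q^{2t}/q^t}\}$ (subsets of $\mathbb{F}_{q^t}$). A pair $(m,h)\in\mathbb{F}_{q^t}^*\times\mathbb{F}_{q^{2t}}$ is called admissible for $(q,t,s)$ if one of the following holds: (i) [$t$ even, or $t$ odd and $q\equiv1\pmod4$] and $m\notin\mathscr{P}^+_s\cup\mathscr{P}^-_s$ and $\mathrm{N}_{q^{2t}/q^t}(h)=\pm1$; (ii)(a) $t$ odd, $q\equiv3\pmod4$, $m\in\mathscr{P}^+_s$ and $\mathrm{N}_{q^{2t}/q^t}(h)=-1$; (ii)(b) $t$ odd, $q\equiv3\pmod4$, $m\notin\mathscr{P}^+_s\cup\mathscr{P}^-_s$, $\mathrm{N}_{q^{2t}/q^t}(h)=1$ and $h^2\neq-1$. $\psi_{m,h,s}= m(X^{q^s}-h^{1-q^{s(t+1)}}X^{q^{s(t+1)}})+X^{q^{s(t-1)}}+h^{1-q^{s(2t-1)}}X^{q^{s(2t-1)}}$, viewed as an $\mathbb{F}_q$-linear map of $\mathbb{F}_{q^{2t}}$. For a linearized polynomial $f$ over $\mathbb{F}_{q^n}$ ($n=2t$), $U_f=\{(x,f(x)):x\in\mathbb{F}_{q^n}\}$,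 $G_f$ is the stabilizer of $U_f$ in $\mathrm{GL}(2,q^n)$ (matrices acting on column vectors $(x,f(x))^{T}$), and $G_f^\circ=G_f\cup\{O\}$ with $O$ the $2\times2$ zero matrix. $\tilde{\mathcal{L}}_{n,q,s}=\{\sum_{i=0}^{n-1}a_iX^{q^{si}}:a_i\in\mathbb{F}_{q^n}\}$ with sum and composition modulo $X^{q^{sn}}-X$ (isomorphic to $\mathrm{End}_{\mathbb{F}_q}(\mathbb{F}_{q^n})$); $\mathcal{C}_f=\{aX+bf:a,b\in\mathbb{F}_{q^n}\}$; the right idealizer of $\mathcal{C}\subseteq\tilde{\mathcal{L}}_{n,q,s}$ is $I_R(\mathcal{C})=\{g\in\tilde{\mathcal{L}}_{n,q,s}: f\circ g\in\mathcal{C}\ \text{for all } f\in\mathcal{C}\}$. *)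

theory Defs
  imports
    "HOL-Analysis.Cartesian_Space"
    "HOL-Computational_Algebra.Polynomial"
    "HOL-Number_Theory.Prime_Powers"
    "HOL-Algebra.QuotRing"
begin

text \<open>
  The ambient field \<open>\<bbbF>\<^bsub>q^(2t)\<^esub>\<close> is a type \<open>'a\<close> of sort \<open>{field, finite}\<close> with
  \<open>CARD('a) = q ^ (2 * t)\<close>. When \<open>k\<close> is the order of a subfield, that subfield is
  \<open>subfld k\<close>.
\<close>

definition subfld :: "nat \<Rightarrow> 'a::{field,finite} set" where
  "subfld k = {x. x ^ k = x}"

definition subfld_ring :: "nat \<Rightarrow> 'a::{field,finite} ring" where
  "subfld_ring k =
     \<lparr>carrier = subfld k, monoid.mult = (*), one = 1, zero = 0, add = (+)\<rparr>"

definition rel_trace :: "nat \<Rightarrow> nat \<Rightarrow> 'a::{field,finite} \<Rightarrow> 'a" where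
  "rel_trace q t x = x + x ^ (q ^ t)"

definition rel_norm :: "nat \<Rightarrow> nat \<Rightarrow> 'a::{field,finite} \<Rightarrow> 'a" where
  "rel_norm q t x = x ^ (q ^ t + 1)"

definition P_plus :: "nat \<Rightarrow> nat \<Rightarrow> nat \<Rightarrow> 'a::{field,finite} set" where
  "P_plus q t s = {w ^ (q ^ s + 1) | w. rel_trace q t w = 0}"

definition P_minus :: "nat \<Rightarrow> nat \<Rightarrow> nat \<Rightarrow> 'a::{field,finite} set" where
  "P_minus q t s = {w ^ (q ^ s - 1) | w. rel_trace q t w = 0}"

definition admissible :: "nat \<Rightarrow> nat \<Rightarrow> nat \<Rightarrow> 'a::{field,finite} \<Rightarrow> 'a \<Rightarrow> bool" where
  "admissible q t s m h \<longleftrightarrow>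
     m \<in> subfld (q ^ t) - {0} \<and>
     ((even t \<or> (odd t \<and> q mod 4 = 1)) \<and>
        m \<notin> P_plus q t s \<union> P_minus q t s \<and> (rel_norm q t h = 1 \<or> rel_norm q t h = - 1)
      \<or> odd t \<and> q mod 4 = 3 \<and> m \<in> P_plus q t s \<and> rel_norm q t h = - 1
      \<or> odd t \<and> q mod 4 = 3 \<and> m \<notin> P_plus q t s \<union> P_minus q t s \<and>
        rel_norm q t h = 1 \<and> h\<^sup>2 \<noteq> - 1)"

text \<open>
  Linearized polynomials are genuine polynomials; as a map of \<open>\<bbbF>\<^bsub>q^(2t)\<^esub>\<close> a polynomial
  \<open>f\<close> is read as \<open>poly f\<close>. The exponents of \<open>h\<close> below are negative integers, hence \<open>powi\<close>.
\<close>

definition psi :: "nat \<Rightarrow> nat \<Rightarrow> 'a::{field,finite} \<Rightarrow> 'a \<Rightarrow> nat \<Rightarrow> 'a poly" where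
  "psi q t m h s =
     smult m (monom 1 (q ^ s)
              - monom (h powi (1 - int q ^ (s * (t + 1)))) (q ^ (s * (t + 1))))
     + monom 1 (q ^ (s * (t - 1)))
     + monom (h powi (1 - int q ^ (s * (2 * t - 1)))) (q ^ (s * (2 * t - 1)))"

definition graph_set :: "'a::{field,finite} poly \<Rightarrow> ('a^2) set" where
  "graph_set f = {vector [x, poly f x] | x. True}"

definition mat22 :: "'a::{field,finite} \<Rightarrow> 'a \<Rightarrow> 'a \<Rightarrow> 'a \<Rightarrow> 'a^2^2" where
  "mat22 a b c d = vector [vector [a, b], vector [c, d]]"

definition stab :: "'a::{field,finite} poly \<Rightarrow> ('a^2^2) set" where
  "stab f = {A. invertible A \<and> (\<lambda>v. A *v v) ` graph_set f = graph_set f}"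

definition stab0 :: "'a::{field,finite} poly \<Rightarrow> ('a^2^2) set" where
  "stab0 f = stab f \<union> {0}"

text \<open>
  The elements of \<open>lin_polys n q s\<close> have degree below \<open>q ^ (s * n)\<close>, so they are the reduced
  representatives modulo \<open>X ^ (q ^ (s * n)) - X\<close>; sums need no reduction, compositions do.
\<close>

definition lin_polys :: "nat \<Rightarrow> nat \<Rightarrow> nat \<Rightarrow> 'a::{field,finite} poly set" where
  "lin_polys n q s = {(\<Sum>i<n. monom (a i) (q ^ (s * i))) | a. True}"

definition lin_comp ::
    "nat \<Rightarrow> nat \<Rightarrow> nat \<Rightarrow> 'a::{field,finite} poly \<Rightarrow> 'a poly \<Rightarrow> 'a poly" where
  "lin_comp n q s f g = (pcompose f g) mod (monom 1 (q ^ (s * n)) - monom 1 1)"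

definition code :: "'a::{field,finite} poly \<Rightarrow> 'a poly set" where
  "code f = {monom a 1 + smult b f | a b. True}"

definition right_idealizer ::
    "nat \<Rightarrow> nat \<Rightarrow> nat \<Rightarrow> 'a::{field,finite} poly set \<Rightarrow> 'a poly set" where
  "right_idealizer n q s C = {g \<in> lin_polys n q s. \<forall>f\<in>C. lin_comp n q s f g \<in> C}"

definition right_idealizer_ring ::
    "nat \<Rightarrow> nat \<Rightarrow> nat \<Rightarrow> 'a::{field,finite} poly set \<Rightarrow> 'a poly ring" where
  "right_idealizer_ring n q s C =
     \<lparr>carrier = right_idealizer n q s C, monoid.mult = lin_comp n q s, one = monom 1 1,
      zero = 0, add = (+)\<rparr>"

text \<open>For odd \<open>t\<close> the division is exact, as \<open>2 * s\<close> divides \<open>s * (t + 1)\<close>.\<close>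

definition R_exp :: "nat \<Rightarrow> nat \<Rightarrow> nat \<Rightarrow> int" where
  "R_exp q t s = - ((int q ^ (s * (t + 1)) - 1) div (int q ^ (2 * s) - 1))"

end

theory Submission
  imports Defs "HOL-Analysis.Determinants" "HOL-Number_Theory.Cong"
begin

text \<open>Write \<open>\<sigma>\<close> for the automorphism \<open>x \<mapsto> x ^ (q ^ s)\<close>, a generator of the Galois group
  of the field over its subfield of order \<open>q\<close>, and \<open>x\<^sup>*\<close> for \<open>x ^ (q ^ t) = \<sigma>\<^sup>t x\<close>. Let
  \<open>e = h h\<^sup>* = \<plusminus>1\<close>. As \<open>h\<^sup>* = e / h\<close>, the map given by \<open>psi\<close> is
  \<open>x \<mapsto> m \<sigma>(x) - m e h \<sigma>(h) \<sigma>(x\<^sup>*) + \<sigma>\<^sup>-\<^sup>1(x\<^sup>*) + (h / \<sigma>\<^sup>-\<^sup>1(h)) \<sigma>\<^sup>-\<^sup>1(x)\<close>.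

  A matrix with rows \<open>(a, b)\<close> and \<open>(c, d)\<close> preserves the graph of \<open>\<psi>\<close> iff
  \<open>\<psi>(a x + b \<psi>(x)) = c x + d \<psi>(x)\<close> for all \<open>x\<close>. Here \<open>\<psi>(a x)\<close> and \<open>d \<psi>(x)\<close> are combinations of the
  powers \<open>\<sigma>\<^sup>i\<close> with \<open>i = \<plusminus>1, t \<plusminus> 1\<close>, whereas \<open>\<psi>(b \<psi>(x))\<close> and \<open>c x\<close> involve only
  \<open>i = 0, t, \<plusminus>2, t \<plusminus> 2\<close>. For \<open>t \<ge> 5\<close> these ten exponents are distinct modulo \<open>2 t\<close>, and distinct
  powers of \<open>\<sigma>\<close> are linearly independent (\<open>frobenius_powers_independent\<close>), so coefficients may be
  compared one by one. Four of the equations say that \<open>a\<close> lies in the subfield of order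
  \<open>q\<^sup>2\<close> (\<open>t\<close> even) or \<open>q\<close> (\<open>t\<close> odd) and that \<open>d = \<sigma>(a)\<close>. The other six collapse
  (\<open>preserves_graph_iff\<close>): with \<open>D = \<sigma>(h) + \<sigma>\<^sup>-\<^sup>1(h\<^sup>*)\<close>, which is not zero by \<open>D_nonzero\<close>, and
  \<open>y = b D\<close> they say \<open>y\<^sup>* = - y\<close>, \<open>m \<sigma>(y) = \<sigma>\<^sup>-\<^sup>1(m y)\<close> and \<open>c = e m \<sigma>(y) D\<close>.

  For such a \<open>y\<close> the element \<open>\<lambda> = m y \<sigma>(y)\<close> is fixed by \<open>\<sigma>\<close>, so it lies in the subfield of order
  \<open>q\<close>, and if \<open>y \<noteq> 0\<close> then \<open>m = \<lambda> (1 / y) ^ (q ^ s + 1)\<close> where \<open>1 / y\<close> has trace zero. For \<open>t\<close> even,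
  \<open>\<lambda>\<close> is a norm from the subfield of order \<open>q\<^sup>2\<close>, on which \<open>x \<mapsto> x\<^sup>*\<close> is trivial; absorbing it
  into \<open>1 / y\<close> puts \<open>m\<close> into \<open>P_plus\<close>, against admissibility, so \<open>b = 0\<close>. For \<open>t\<close> odd, the
  equation for \<open>y\<close> has exactly the solutions \<open>\<xi> m\<^sup>R\<close> of the theorem. The determinant of the
  resulting matrix is \<open>\<alpha>\<^sup>2 - e \<lambda>\<close>, and admissibility makes \<open>e \<lambda>\<close> a nonsquare in the subfield of
  order \<open>q\<close> (\<open>stab_offset_nonsquare\<close>), so only the zero matrix is singular.

  The right idealizer consists of the \<open>a X + b \<psi>\<close> for which \<open>(a, b)\<close> is the first row of such a
  matrix, and composition corresponds to the matrix product. For \<open>t\<close> odd this is the ring of all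
  \<open>\<alpha> + r B\<close> with \<open>\<alpha>, r\<close> in the subfield of order \<open>q\<close> and \<open>B\<^sup>2\<close> a nonsquare scalar of that subfield:
  its quadratic extension.\<close>

section \<open>Powers in finite fields\<close>

lemma power_card_minus_one:
  fixes x :: "'a::{field,finite}"
  assumes "x \<noteq> 0"
  shows "x ^ (CARD('a) - 1) = 1"
proof -
  have "(\<Prod>y\<in>UNIV-{0}. x * y) = (\<Prod>y\<in>UNIV-{0}. y)"
    by (rule prod.reindex_bij_witness[of _ "\<lambda>y. y / x" "\<lambda>y. x * y"]) (use assms in auto)
  then have "x ^ (CARD('a) - 1) * (\<Prod>y\<in>UNIV-{0::'a}. y) = (\<Prod>y\<in>UNIV-{0::'a}. y)"
    by (simp add: prod.distrib card_Diff_singleton)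
  then show ?thesis by simp
qed

lemma power_card_same:
  fixes x :: "'a::{field,finite}"
  shows "x ^ CARD('a) = x"
proof (cases "x = 0")
  case False
  have "x ^ CARD('a) = x ^ (CARD('a) - 1) * x"
    by (simp flip: power_Suc2)
  then show ?thesis using power_card_minus_one[OF False] by simp
qed simp

lemma card_power_eq_le:
  fixes c :: "'a::{field,finite}"
  assumes "k > 0"
  shows "card {x. x ^ k = c} \<le> k"
proof -
  have nz: "monom (1::'a) k - [:c:] \<noteq> 0"
  proof
    assume "monom (1::'a) k - [:c:] = 0"
    then have "coeff (monom (1::'a) k - [:c:]) k = 0" by simp
    then show False using assms by (cases k) auto
  qed
  have "card {x. x ^ k = c} = card {x. poly (monom 1 k - [:c:]) x = 0}"
    by (simp add: poly_monom)
  also have "\<dots> \<le> degree (monom 1 k - [:c:])" by (rule card_poly_roots_bound[OF nz])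
  also have "\<dots> \<le> k" by (rule degree_diff_le) (auto simp: degree_monom_le)
  finally show ?thesis .
qed

text \<open>Counting replaces the cyclicity of the multiplicative group: the nonzero \<open>d\<close>-th powers are
  roots of \<open>X\<^sup>e - 1\<close>, and as every fibre of \<open>y \<mapsto> y\<^sup>d\<close> has at most \<open>d\<close> elements, there are at least
  \<open>e\<close> of them. So they exhaust the roots.\<close>

lemma power_eq_one_imp_power_residue:
  fixes x :: "'a::{field,finite}"
  assumes de: "d * e = CARD('a) - 1" and x: "x ^ e = 1"
  obtains y where "y ^ d = x"
proof -
  have "CARD('a) \<ge> card {0, 1::'a}" by (intro card_mono) auto
  then have pos: "d > 0" "e > 0" using de by (auto intro!: Nat.gr0I)
  let ?P = "(\<lambda>y::'a. y ^ d) ` (UNIV - {0})"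
  let ?R = "{z::'a. z ^ e = 1}"
  have sub: "?P \<subseteq> ?R"
    using power_card_minus_one[where 'a = 'a] by (auto simp: de simp flip: power_mult)
  have "d * e = card (UNIV - {0::'a})" by (simp add: de card_Diff_singleton)
  also have "UNIV - {0::'a} = (\<Union>z\<in>?P. {y \<in> UNIV - {0}. y ^ d = z})" by auto
  also have "card \<dots> \<le> (\<Sum>z\<in>?P. card {y \<in> UNIV - {0}. y ^ d = z})"
    by (rule card_UN_le) simp
  also have "\<dots> \<le> (\<Sum>z\<in>?P. d)"
  proof (rule sum_mono)
    fix z :: 'a
    have "card {y \<in> UNIV - {0}. y ^ d = z} \<le> card {y. y ^ d = z}" by (rule card_mono) auto
    also have "\<dots> \<le> d" by (rule card_power_eq_le[OF pos(1)])
    finally show "card {y \<in> UNIV - {0}. y ^ d = z} \<le> d" .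
  qed
  finally have "e \<le> card ?P" using pos(1) by (simp add: mult.commute)
  then have "card ?R \<le> card ?P" using card_power_eq_le[OF pos(2), of "1::'a"] by linarith
  then have "?P = ?R" by (intro card_seteq) (use sub in auto)
  then have "x \<in> ?P" using x by blast
  then show ?thesis using that by blast
qed

lemma iterated_power_fixed:
  fixes x :: "'a::monoid_mult"
  assumes "x ^ (q ^ a) = x"
  shows "x ^ (q ^ (a * k)) = x"
  by (induction k) (use assms in \<open>simp_all add: power_add power_mult\<close>)

text \<open>The exponents \<open>k\<close> for which \<open>x ^ (q ^ k) = x\<close> are stable under the steps of the Euclidean
  algorithm.\<close>

lemma power_fixed_gcd:
  fixes x :: "'a::monoid_mult"
  shows "x ^ (q ^ a) = x \<Longrightarrow> x ^ (q ^ b) = x \<Longrightarrow> x ^ (q ^ gcd a b) = x"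
proof (induction a b rule: gcd_nat_induct)
  case (step a b)
  have "x = x ^ (q ^ (b * (a div b) + a mod b))" using step.prems by simp
  also have "\<dots> = (x ^ (q ^ (b * (a div b)))) ^ (q ^ (a mod b))"
    by (simp only: power_add power_mult)
  also have "\<dots> = x ^ (q ^ (a mod b))" by (simp only: iterated_power_fixed[OF step.prems(2)])
  finally have "x ^ (q ^ (a mod b)) = x" by simp
  from step.IH[OF step.prems(2) this] show ?case by (simp only: gcd_red_nat[symmetric])
qed simp

text \<open>Translation by 1 permutes a finite ring, so the sum of all elements absorbs \<open>CARD('a)\<close> ones.\<close>

lemma of_nat_card_eq_zero: "of_nat CARD('a) = (0::'a::{comm_ring_1,finite})"
proof -
  have "(\<Sum>x\<in>UNIV. x + 1) = (\<Sum>x\<in>UNIV. x :: 'a)"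
    by (rule sum.reindex_bij_witness[of _ "\<lambda>x. x - 1" "\<lambda>x. x + 1"]) auto
  then show ?thesis by (simp add: sum.distrib)
qed

lemma primepow_eq_CHAR_power:
  assumes "primepow q" and "CARD('a::{field,finite}) = q ^ k"
  obtains j where "q = CHAR('a) ^ j"
proof -
  obtain p j where p: "prime p" and q: "q = p ^ j"
    using assms(1) by (auto simp: primepow_def)
  have pr: "prime CHAR('a)" by (rule prime_CHAR_semidom) (simp add: finite_imp_CHAR_pos)
  have "CHAR('a) dvd p ^ (j * k)"
    using of_nat_card_eq_zero[where 'a = 'a] assms(2) q
    by (simp only: power_mult of_nat_eq_0_iff_char_dvd)
  then have "CHAR('a) dvd p" using pr prime_dvd_power by blast
  then have "CHAR('a) = p" using p pr primes_dvd_imp_eq by blast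
  then show ?thesis using q that by blast
qed

section \<open>The Frobenius automorphisms of the field\<close>

text \<open>A common source of the simplification rules for the three automorphisms below.\<close>

locale field_endo =
  fixes f :: "'a::field \<Rightarrow> 'a"
  assumes add [simp]: "f (x + y) = f x + f y"
    and mult [simp]: "f (x * y) = f x * f y"
    and one [simp]: "f 1 = 1"
begin

lemma zero [simp]: "f 0 = 0"
  by (metis add add_0 add_cancel_left_left)

lemma minus [simp]: "f (- x) = - f x"
  using add[of x "- x"] by (simp add: eq_neg_iff_add_eq_0 add.commute)

lemma diff [simp]: "f (x - y) = f x - f y"
  using add[of x "- y"] by simp

lemma eq_zero_iff [simp]: "f x = 0 \<longleftrightarrow> x = 0"
  using mult[of x "inverse x"] by (cases "x = 0") auto

lemma inverse [simp]: "f (inverse x) = inverse (f x)"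
proof (cases "x = 0")
  case False
  then have "f x * f (inverse x) = 1" using mult[of x "inverse x"] by simp
  then show ?thesis by (simp add: inverse_unique)
qed simp

lemma divide [simp]: "f (x / y) = f x / f y"
  by (simp add: field_class.field_divide_inverse)

lemma power [simp]: "f (x ^ n) = f x ^ n"
  by (induction n) auto

lemma eq_iff [simp]: "f x = f y \<longleftrightarrow> x = y"
  using eq_zero_iff[of "x - y"] by auto

end

text \<open>The token \<open>ty\<close> ties the locale to the field, which the numbers \<open>q, t, s\<close> alone do not mention.\<close>

locale galois_field =
  fixes q t s :: nat and ty :: "'a::{field,finite} itself"
  assumes primepow: "primepow q" and odd_q: "odd q" and t5: "t \<ge> 5"
    and coprime_s: "coprime s (2 * t)" and card: "CARD('a) = q ^ (2 * t)"
begin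

lemma q_gt_1: "q > 1"
  using primepow_gt_Suc_0[OF primepow] by simp

lemma odd_s: "odd s"
  using coprime_s by auto

lemma neg_one_ne_one: "(-1::'a) \<noteq> 1"
proof
  assume eq: "(-1::'a) = 1"
  obtain j where j: "q = CHAR('a) ^ j"
    using primepow_eq_CHAR_power[OF primepow card] .
  have "of_nat 2 = (1::'a) + 1" by simp
  also have "\<dots> = 0" using eq by (metis add.left_inverse)
  finally have "CHAR('a) dvd 2" by (simp only: of_nat_eq_0_iff_char_dvd)
  then have "CHAR('a) = 1 \<or> CHAR('a) = 2" using prime_nat_iff two_is_prime_nat by auto
  then show False using j odd_q q_gt_1 by (cases j) auto
qed

lemma two_ne_zero: "(2::'a) \<noteq> 0"
  using neg_one_ne_one by (metis add.inverse_unique one_add_one)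

lemma eq_neg_self_iff: "(x::'a) = - x \<longleftrightarrow> x = 0"
proof
  assume "x = - x"
  then have "2 * x = 0" by (metis add.left_inverse mult_2)
  then show "x = 0" using two_ne_zero by simp
qed simp

lemma q_eq_CHAR_power: obtains j where "q = CHAR('a) ^ j" and "prime CHAR('a)"
proof -
  have "prime CHAR('a)" by (rule prime_CHAR_semidom) (simp add: finite_imp_CHAR_pos)
  then show ?thesis using primepow_eq_CHAR_power[OF primepow card] that by blast
qed

lemma frobenius_add: "(x + y :: 'a) ^ (q ^ k) = x ^ (q ^ k) + y ^ (q ^ k)"
proof -
  obtain j where "q = CHAR('a) ^ j" "prime CHAR('a)" by (rule q_eq_CHAR_power)
  then show ?thesis by (intro freshmans_dream'[where n = "j * k"]) (auto simp: power_mult)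
qed

lemma frobenius_sum_poly: "(sum f A :: 'a poly) ^ (q ^ k) = (\<Sum>i\<in>A. f i ^ (q ^ k))"
proof -
  obtain j where "q = CHAR('a) ^ j" "prime CHAR('a)" by (rule q_eq_CHAR_power)
  then show ?thesis by (intro freshmans_dream_sum'[where n = "j * k"]) (auto simp: power_mult)
qed

lemma frobenius_diff_poly: "(x - y :: 'a poly) ^ (q ^ k) = x ^ (q ^ k) - y ^ (q ^ k)"
proof -
  obtain j where "q = CHAR('a) ^ j" "prime CHAR('a)" by (rule q_eq_CHAR_power)
  then have "(x - y + y) ^ (q ^ k) = (x - y) ^ (q ^ k) + y ^ (q ^ k)"
    by (intro freshmans_dream'[where n = "j * k"]) (auto simp: power_mult)
  then show ?thesis by simp
qed

lemma frobenius_mod: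
  fixes x :: 'a
  assumes "i mod (2 * t) = j mod (2 * t)"
  shows "x ^ (q ^ i) = x ^ (q ^ j)"
proof -
  have *: "x ^ (q ^ i) = x ^ (q ^ (i mod (2 * t)))" for i
  proof -
    have "x ^ (q ^ i) = x ^ (q ^ (2 * t * (i div (2 * t)) + i mod (2 * t)))" by simp
    also have "\<dots> = (x ^ (q ^ (2 * t * (i div (2 * t))))) ^ (q ^ (i mod (2 * t)))"
      by (simp only: power_add power_mult)
    also have "\<dots> = x ^ (q ^ (i mod (2 * t)))"
      by (subst iterated_power_fixed) (simp_all flip: card add: power_card_same)
    finally show ?thesis .
  qed
  show ?thesis using *[of i] *[of j] assms by simp
qed

text \<open>\<open>tau\<close> is the inverse of \<open>sg\<close>, and \<open>bar\<close> is an involution equal to the \<open>t\<close>-th power of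
  \<open>sg\<close> because \<open>s\<close> is odd. Keeping the three as separate commuting endomorphisms lets rewriting move
  \<open>bar\<close> innermost and cancel \<open>sg\<close> against \<open>tau\<close>, without exponent arithmetic.\<close>

definition sg :: "'a \<Rightarrow> 'a" where "sg x = x ^ (q ^ s)"
definition tau :: "'a \<Rightarrow> 'a" where "tau x = x ^ (q ^ (s * (2 * t - 1)))"
definition bar :: "'a \<Rightarrow> 'a" where "bar x = x ^ (q ^ t)"

sublocale sg: field_endo sg
  by unfold_locales (auto simp: sg_def frobenius_add power_mult_distrib)

sublocale tau: field_endo tau
  by unfold_locales (auto simp: tau_def frobenius_add power_mult_distrib)

sublocale bar: field_endo bar
  by unfold_locales (auto simp: bar_def frobenius_add power_mult_distrib)

lemma power_q_power_q: "((x::'a) ^ (q ^ i)) ^ (q ^ j) = x ^ (q ^ (i + j))"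
  by (simp add: power_add power_mult)

lemma sg_tau [simp]: "sg (tau x) = x"
proof -
  have "s * (2 * t - 1) + s = 2 * t * s"
    using t5 by (cases t) (auto simp: algebra_simps)
  then have "sg (tau x) = x ^ (q ^ (2 * t * s))"
    unfolding sg_def tau_def power_q_power_q by simp
  also have "\<dots> = x ^ (q ^ 0)" by (rule frobenius_mod) simp
  finally show ?thesis by simp
qed

lemma tau_sg [simp]: "tau (sg x) = x"
  using sg.eq_iff[of "tau (sg x)" x] by simp

lemma bar_bar [simp]: "bar (bar x) = x"
proof -
  have "bar (bar x) = x ^ (q ^ 0)"
    unfolding bar_def power_q_power_q by (rule frobenius_mod) (simp flip: mult_2)
  then show ?thesis by simp
qed

lemma bar_sg [simp]: "bar (sg x) = sg (bar x)"
  unfolding bar_def sg_def power_q_power_q by (simp add: add.commute)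

lemma bar_tau [simp]: "bar (tau x) = tau (bar x)"
  unfolding bar_def tau_def power_q_power_q by (simp add: add.commute)

lemma power_s_mult_t_add: "(x::'a) ^ (q ^ (s * t + i)) = bar x ^ (q ^ i)"
proof -
  have "odd s" by (rule odd_s)
  then obtain k where k: "s = 2 * k + 1" by (elim oddE)
  have "s * t + i = (t + i) + 2 * t * k" by (simp add: k algebra_simps)
  then have "(s * t + i) mod (2 * t) = (t + i) mod (2 * t)" by (simp only: mod_mult_self2)
  then have "x ^ (q ^ (s * t + i)) = x ^ (q ^ (t + i))" by (rule frobenius_mod)
  then show ?thesis unfolding bar_def power_q_power_q .
qed

lemma inj_on_mult_s_mod: "inj_on (\<lambda>i. s * i mod (2 * t)) {..<2 * t}"
proof (rule inj_onI)
  fix i j assume ij: "i \<in> {..<2 * t}" "j \<in> {..<2 * t}" "s * i mod (2 * t) = s * j mod (2 * t)"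
  then have "[s * i = s * j] (mod (2 * t))" by (simp add: cong_def)
  then have "[i = j] (mod (2 * t))" using coprime_s cong_mult_lcancel_nat by blast
  then show "i = j" using ij by (simp add: cong_def)
qed

text \<open>Reducing the exponents \<open>s i\<close> modulo \<open>2 t\<close>, which is injective because \<open>s\<close> is a unit, turns a
  vanishing combination into a polynomial of degree at most \<open>q ^ (2 t - 1)\<close> that has every one of the
  \<open>q ^ (2 t)\<close> field elements as a root.\<close>

lemma frobenius_powers_independent:
  assumes dist: "distinct (map snd L)" and range: "snd ` set L \<subseteq> {..<2 * t}"
    and zero: "\<And>x::'a. (\<Sum>(c, i)\<leftarrow>L. c * x ^ (q ^ (s * i))) = 0"
    and mem: "(c, i) \<in> set L"
  shows "c = 0"
proof -
  define ex where "ex i = s * i mod (2 * t)" for i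
  define P where "P = (\<Sum>(c, i)\<in>set L. monom c (q ^ ex i))"
  have distL: "distinct L" using dist by (simp add: distinct_map)
  have "poly P x = (\<Sum>(c, i)\<leftarrow>L. c * x ^ (q ^ (s * i)))" for x
  proof -
    have "x ^ (q ^ ex i) = x ^ (q ^ (s * i))" for i
      unfolding ex_def by (rule frobenius_mod) simp
    then show ?thesis
      unfolding P_def poly_sum sum_list_distinct_conv_sum_set[OF distL]
      by (intro sum.cong) (auto simp: poly_monom)
  qed
  then have roots: "{x. poly P x = 0} = UNIV" using zero by simp
  have "degree P \<le> q ^ (2 * t - 1)"
    unfolding P_def
  proof (rule degree_sum_le)
    fix p assume "p \<in> set L"
    obtain c i where p: "p = (c, i)" by force
    have "ex i < 2 * t" unfolding ex_def using t5 by simp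
    then have "q ^ ex i \<le> q ^ (2 * t - 1)" using q_gt_1 by (intro power_increasing) auto
    then show "degree (case p of (c, i) \<Rightarrow> monom c (q ^ ex i)) \<le> q ^ (2 * t - 1)"
      unfolding p using degree_monom_le[of c "q ^ ex i"] by simp
  qed simp
  also have "\<dots> < CARD('a)" unfolding card using q_gt_1 t5 by (intro power_strict_increasing) auto
  finally have "P = 0" using card_poly_roots_bound[of P] roots by fastforce
  then have "0 = coeff P (q ^ ex i)" by simp
  also have "\<dots> = (\<Sum>p\<in>set L. if p = (c, i) then c else 0)"
    unfolding P_def coeff_sum
  proof (rule sum.cong)
    fix p assume p: "p \<in> set L"
    obtain d j where dj: "p = (d, j)" by force
    have "q ^ ex j = q ^ ex i \<longleftrightarrow> j = i"
      using inj_onD[OF inj_on_mult_s_mod, of j i] p mem range q_gt_1 unfolding dj ex_def by force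
    moreover have "j = i \<longleftrightarrow> p = (c, i)"
      using dist p mem unfolding dj distinct_map inj_on_def by fastforce
    ultimately have "q ^ ex j = q ^ ex i \<longleftrightarrow> p = (c, i)" by (rule trans)
    then show "coeff (case p of (c, i) \<Rightarrow> monom c (q ^ ex i)) (q ^ ex i)
        = (if p = (c, i) then c else 0)"
      unfolding dj prod.case coeff_monom by (cases "(d, j) = (c, i)") (simp, simp only: if_False)
  qed simp
  also have "\<dots> = c" using mem by simp
  finally show ?thesis by simp
qed

end

section \<open>Comparing coefficients\<close>

context galois_field
begin

lemma power_t_plus_1: "(x::'a) ^ (q ^ (s * (t + 1))) = sg (bar x)"
  using power_s_mult_t_add[of x s] by (simp only: sg_def add_mult_distrib2 mult_1_right)

lemma power_t_minus_1: "(x::'a) ^ (q ^ (s * (t - 1))) = tau (bar x)"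
proof -
  have "s * t + s * (2 * t - 1) = s * (t - 1) + 2 * t * s"
    using t5 by (cases t) (auto simp: algebra_simps)
  then have "s * (t - 1) mod (2 * t) = (s * t + s * (2 * t - 1)) mod (2 * t)"
    by (simp only: mod_mult_self2)
  then show ?thesis unfolding tau_def by (subst power_s_mult_t_add[symmetric]) (rule frobenius_mod)
qed

lemma power_t: "(x::'a) ^ (q ^ (s * t)) = bar x"
  using power_s_mult_t_add[of x 0] by simp

lemma power_2: "(x::'a) ^ (q ^ (s * 2)) = sg (sg x)"
  unfolding sg_def power_q_power_q by (simp add: mult_2_right)

lemma power_t_plus_2: "(x::'a) ^ (q ^ (s * (t + 2))) = sg (sg (bar x))"
  using power_s_mult_t_add[of x "s * 2"] by (simp only: power_2 add_mult_distrib2)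

lemma power_minus_2: "(x::'a) ^ (q ^ (s * (2 * t - 2))) = tau (tau x)"
proof -
  have "s * (2 * t - 1) + s * (2 * t - 1) = s * (2 * t - 2) + 2 * t * s"
  proof -
    obtain u where u: "t = 2 + u" using le_Suc_ex[of 2 t] t5 by auto
    show ?thesis unfolding u by (simp add: algebra_simps)
  qed
  then have "s * (2 * t - 2) mod (2 * t) = (s * (2 * t - 1) + s * (2 * t - 1)) mod (2 * t)"
    by (simp only: mod_mult_self2)
  then show ?thesis unfolding tau_def power_q_power_q by (rule frobenius_mod)
qed

lemma power_t_minus_2: "(x::'a) ^ (q ^ (s * (t - 2))) = tau (tau (bar x))"
proof -
  have "s * t + s * (2 * t - 2) = s * (t - 2) + 2 * t * s"
  proof -
    obtain u where u: "t = 2 + u" using le_Suc_ex[of 2 t] t5 by auto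
    show ?thesis unfolding u by (simp add: algebra_simps)
  qed
  then have "s * (t - 2) mod (2 * t) = (s * t + s * (2 * t - 2)) mod (2 * t)"
    by (simp only: mod_mult_self2)
  then have "x ^ (q ^ (s * (t - 2))) = bar x ^ (q ^ (s * (2 * t - 2)))"
    by (subst power_s_mult_t_add[symmetric]) (rule frobenius_mod)
  then show ?thesis by (simp add: power_minus_2)
qed

text \<open>The exponents of \<open>\<sigma>\<close> are \<open>0, t, 1, t + 1, -1, t - 1, 2, t + 2, -2, t - 2\<close>; this is where
  \<open>t \<ge> 5\<close> is used, as \<open>2 = t - 2\<close> for \<open>t = 4\<close> and \<open>2 = t - 1\<close> for \<open>t = 3\<close>.\<close>

lemma ten_maps_independent:
  assumes "\<And>x. c0 * x + c1 * bar x + c2 * sg x + c3 * sg (bar x) + c4 * tau x + c5 * tau (bar x)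
    + c6 * sg (sg x) + c7 * sg (sg (bar x)) + c8 * tau (tau x) + c9 * tau (tau (bar x)) = 0"
  shows "c0 = 0 \<and> c1 = 0 \<and> c2 = 0 \<and> c3 = 0 \<and> c4 = 0 \<and> c5 = 0 \<and> c6 = 0 \<and> c7 = 0 \<and> c8 = 0 \<and> c9 = 0"
proof -
  define L where "L = [(c0, 0), (c1, t), (c2, 1), (c3, t + 1), (c4, 2 * t - 1), (c5, t - 1),
    (c6, 2), (c7, t + 2), (c8, 2 * t - 2), (c9, t - 2)]"
  have dist: "distinct (map snd L)" and range: "snd ` set L \<subseteq> {..<2 * t}"
    using t5 unfolding L_def by auto
  have "(\<Sum>(c, i)\<leftarrow>L. c * x ^ (q ^ (s * i))) = 0" for x :: 'a
    using assms[of x]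
    by (simp only: L_def list.map sum_list.Cons sum_list.Nil prod.case power_t power_t_plus_1
        power_t_minus_1 power_2 power_t_plus_2 power_minus_2 power_t_minus_2
        tau_def[symmetric] mult_1_right mult_0_right power_0 power_one_right sg_def[symmetric]
        add.assoc add_0_right)
  then have "c = 0" if "(c, i) \<in> set L" for c i
    using frobenius_powers_independent[OF dist range _ that] by blast
  then show ?thesis unfolding L_def by (auto)
qed

text \<open>The coefficients of \<open>x, x\<^sup>*, \<sigma>(x), \<sigma>(x\<^sup>*), \<sigma>\<^sup>-\<^sup>1(x), \<sigma>\<^sup>-\<^sup>1(x\<^sup>*), \<sigma>\<^sup>2(x), \<sigma>\<^sup>2(x\<^sup>*), \<sigma>\<^sup>-\<^sup>2(x),
  \<sigma>\<^sup>-\<^sup>2(x\<^sup>*)\<close>, in this order. Unspecified \<open>A, B, G\<close> keep the expansion a pure ring computation; the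
  relation between \<open>h\<close> and \<open>h\<^sup>*\<close> enters only afterwards.\<close>

lemma quadrinomial_invariance_iff:
  fixes A B G a b c d :: 'a
  defines "P \<equiv> \<lambda>x. A * sg x + B * sg (bar x) + tau (bar x) + G * tau x"
  shows "(\<forall>x. P (a * x + b * P x) = c * x + d * P x) \<longleftrightarrow>
    A * sg b * sg G + B * sg (bar b) + tau (bar b) * tau (bar B) + G * tau b * tau A = c \<and>
    A * sg b + B * sg (bar b) * sg (bar G) + tau (bar b) * tau (bar A) + G * tau b * tau B = 0 \<and>
    A * (sg a - d) = 0 \<and> B * (sg (bar a) - d) = 0 \<and> G * (tau a - d) = 0 \<and> tau (bar a) - d = 0 \<and>
    A * sg b * sg A + B * sg (bar b) * sg (bar B) = 0 \<and>
    A * sg b * sg B + B * sg (bar b) * sg (bar A) = 0 \<and>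
    tau (bar b) + G * tau b * tau G = 0 \<and>
    tau (bar b) * tau (bar G) + G * tau b = 0"
    (is "?L \<longleftrightarrow> ?c0 = c \<and> ?c1 = 0 \<and> ?c2 = 0 \<and> ?c3 = 0 \<and> ?c4 = 0 \<and> ?c5 = 0
      \<and> ?c6 = 0 \<and> ?c7 = 0 \<and> ?c8 = 0 \<and> ?c9 = 0")
proof -
  have eq: "P (a * x + b * P x) - (c * x + d * P x) =
    (?c0 - c) * x + ?c1 * bar x + ?c2 * sg x + ?c3 * sg (bar x) + ?c4 * tau x + ?c5 * tau (bar x)
    + ?c6 * sg (sg x) + ?c7 * sg (sg (bar x)) + ?c8 * tau (tau x) + ?c9 * tau (tau (bar x))" for x
    unfolding P_def by (simp add: algebra_simps)
  show ?thesis
  proof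
    assume ?L
    then have "(?c0 - c) * x + ?c1 * bar x + ?c2 * sg x + ?c3 * sg (bar x) + ?c4 * tau x
      + ?c5 * tau (bar x) + ?c6 * sg (sg x) + ?c7 * sg (sg (bar x)) + ?c8 * tau (tau x)
      + ?c9 * tau (tau (bar x)) = 0" for x
      unfolding eq[symmetric] by simp
    from ten_maps_independent[OF this]
    show "?c0 = c \<and> ?c1 = 0 \<and> ?c2 = 0 \<and> ?c3 = 0 \<and> ?c4 = 0 \<and> ?c5 = 0
      \<and> ?c6 = 0 \<and> ?c7 = 0 \<and> ?c8 = 0 \<and> ?c9 = 0" by simp
  next
    assume cs: "?c0 = c \<and> ?c1 = 0 \<and> ?c2 = 0 \<and> ?c3 = 0 \<and> ?c4 = 0 \<and> ?c5 = 0
      \<and> ?c6 = 0 \<and> ?c7 = 0 \<and> ?c8 = 0 \<and> ?c9 = 0"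
    have "P (a * x + b * P x) - (c * x + d * P x) = 0" for x
      unfolding eq using cs by (simp only: diff_self mult_zero_left add_0_left)
    then show ?L by simp
  qed
qed

end

text \<open>The two ring identities behind the coefficients of \<open>x\<^sup>*\<close> and \<open>x\<close>. The letters stand for \<open>x = e\<close>,
  \<open>h' = h\<close>, \<open>H = \<sigma>(h)\<close>, \<open>T = \<sigma>\<^sup>-\<^sup>1(h)\<close>, \<open>m' = m\<close> and \<open>tm = \<sigma>\<^sup>-\<^sup>1(m)\<close>; a trailing \<open>b\<close> on one of
  \<open>h, H, T\<close> marks its image under the involution, and \<open>sb, sbb, tb, tbb\<close> are
  \<open>\<sigma>(b), \<sigma>(b\<^sup>*), \<sigma>\<^sup>-\<^sup>1(b), \<sigma>\<^sup>-\<^sup>1(b\<^sup>*)\<close>.\<close>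

lemma coeff_bar_identity:
  fixes x :: "'a::comm_ring_1"
  assumes "h' * hb = x" "H * Hb = x" "T * Tb = x" "x * x = 1"
  shows "hb * (m' * sb + - (m' * x * h' * H) * sbb * (x * Hb * h') + tbb * tm
      + x * h' * Tb * tb * - (tm * x * T * h')) = m' * (hb * sb - h' * sbb) + tm * (hb * tbb - h' * tb)"
    (is "?l = _")
proof -
  have "?l = m' * sb * hb - m' * sbb * h' * (x * x) * ((H * Hb) * (h' * hb)) + tbb * tm * hb
      - tm * tb * h' * (x * x) * ((T * Tb) * (h' * hb))"
    by (simp add: algebra_simps)
  then show ?thesis by (simp add: assms algebra_simps)
qed

lemma coeff_id_identity:
  fixes x :: "'a::comm_ring_1"
  shows "m' * sb * (x * H * hb) + - (m' * x * h' * H) * sbb + tbb * - (tm * x * Tb * hb)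
      + x * h' * Tb * tb * tm = x * m' * H * (hb * sb - h' * sbb) - x * Tb * (tm * (hb * tbb - h' * tb))"
  by (simp add: algebra_simps)

locale psi_field = galois_field q t s ty
  for q t s :: nat and ty :: "'a::{field,finite} itself" +
  fixes m h :: 'a
  assumes adm: "admissible q t s m h"
begin

definition e :: 'a where "e = rel_norm q t h"

lemma e_cases: "e = 1 \<or> e = - 1"
  using adm unfolding admissible_def e_def by auto

lemma m_nonzero [simp]: "m \<noteq> 0" and bar_m [simp]: "bar m = m"
  using adm unfolding admissible_def by (auto simp: subfld_def bar_def)

lemma e_e [simp]: "e * e = 1" and e_nonzero [simp]: "e \<noteq> 0"
  and sg_e [simp]: "sg e = e" and tau_e [simp]: "tau e = e" and bar_e [simp]: "bar e = e"
  using e_cases by auto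

lemma h_bar_h: "h * bar h = e"
  by (simp add: e_def rel_norm_def bar_def)

lemma h_nonzero [simp]: "h \<noteq> 0"
  using h_bar_h e_nonzero mult_zero_left by metis

text \<open>All quotients are cleared by \<open>h h\<^sup>* = e\<close> and \<open>e\<^sup>2 = 1\<close>: \<open>h / \<sigma>(h\<^sup>*) = e h \<sigma>(h)\<close> and
  \<open>h / \<sigma>\<^sup>-\<^sup>1(h) = e h \<sigma>\<^sup>-\<^sup>1(h\<^sup>*)\<close>.\<close>

definition psi_map :: "'a \<Rightarrow> 'a" where
  "psi_map x = m * sg x + - (m * e * h * sg h) * sg (bar x) + tau (bar x) + e * h * tau (bar h) * tau x"

text \<open>The denominator of the upper right entry of the matrices for odd \<open>t\<close>. Multiplication by it turns
  the equation \<open>\<sigma>(h) b + \<sigma>\<^sup>-\<^sup>1(h) b\<^sup>* = 0\<close> for \<open>b\<close> into the vanishing of a trace.\<close>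

definition D :: 'a where "D = sg h + tau (bar h)"

lemma h_powi: "h powi (1 - int q ^ k) = h / h ^ (q ^ k)"
proof -
  have "int q ^ k = int (q ^ k)" by simp
  then have "h powi (1 - int q ^ k) = h powi (1 - int (q ^ k))" by (simp only:)
  also have "\<dots> = h powi 1 / h powi int (q ^ k)" by (rule power_int_diff) simp
  finally show ?thesis by (simp only: power_int_1_right power_int_of_nat)
qed

lemma sg_h_bar_h: "sg h * sg (bar h) = e" and tau_h_bar_h: "tau h * tau (bar h) = e"
  using h_bar_h by (metis sg.mult sg_e) (metis h_bar_h tau.mult tau_e)

lemma poly_psi: "poly (psi q t m h s) x = psi_map x"
proof -
  have "h / sg (bar h) = e * h * sg h"
  proof -
    have "h = (e * e) * h" by simp
    then have "h = e * h * sg h * sg (bar h)" by (simp only: sg_h_bar_h[symmetric] mult_ac)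
    then show ?thesis by (simp add: nonzero_divide_eq_eq)
  qed
  moreover have "h / tau h = e * h * tau (bar h)"
  proof -
    have "h = (e * e) * h" by simp
    then have "h = e * h * tau (bar h) * tau h" by (simp only: tau_h_bar_h[symmetric] mult_ac)
    then show ?thesis by (simp add: nonzero_divide_eq_eq)
  qed
  moreover have "poly (psi q t m h s) x = m * (sg x - h / sg (bar h) * sg (bar x))
      + tau (bar x) + h / tau h * tau x"
    unfolding psi_def h_powi
    by (simp only: poly_add poly_diff poly_smult poly_monom power_t_plus_1 power_t_minus_1
        sg_def[symmetric] tau_def[symmetric] mult_1_left)
  ultimately have "poly (psi q t m h s) x = m * (sg x - e * h * sg h * sg (bar x))
      + tau (bar x) + e * h * tau (bar h) * tau x" by simp
  then show ?thesis unfolding psi_map_def by (simp add: algebra_simps)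
qed

text \<open>Once the coefficients at \<open>\<sigma>\<^sup>\<plusminus>\<^sup>2\<close> vanish, \<open>b D\<close> has a second expression; the coefficients of \<open>x\<close> and
  \<open>x\<^sup>*\<close> show these expressions after \<open>\<sigma>\<close> and \<open>\<sigma>\<^sup>-\<^sup>1\<close>.\<close>

lemma y_forms:
  assumes T0: "sg h * b + tau h * bar b = 0"
  shows "b * D = tau (bar h) * b - tau h * bar b"
    and "bar (b * D) = sg (bar h) * bar b - sg h * b"
proof -
  have T1: "sg h * b = - (tau h * bar b)" using T0 by (simp only: eq_neg_iff_add_eq_0)
  show "b * D = tau (bar h) * b - tau h * bar b"
    using T1 by (simp add: D_def distrib_left mult.commute)
  have T2: "tau h * bar b = - (sg h * b)"
    using T0 by (simp only: eq_neg_iff_add_eq_0 add.commute)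
  have "bar (b * D) = sg (bar h) * bar b + tau h * bar b"
    by (simp add: D_def distrib_left mult.commute)
  then show "bar (b * D) = sg (bar h) * bar b - sg h * b"
    unfolding T2 by simp
qed

lemma sg_b_D:
  assumes "b * D = tau (bar h) * b - tau h * bar b"
  shows "sg (b * D) = bar h * sg b - h * sg (bar b)"
  unfolding assms by simp

lemma tau_m_bar_b_D:
  assumes "bar (b * D) = sg (bar h) * bar b - sg h * b"
  shows "tau (m * bar (b * D)) = tau m * (bar h * tau (bar b) - h * tau b)"
  unfolding assms by simp

lemma coeff_bar:
  assumes "sg h * b + tau h * bar b = 0"
  shows "bar h * (m * sg b + - (m * e * h * sg h) * sg (bar b) * sg (bar (e * h * tau (bar h)))
      + tau (bar b) * tau (bar m) + e * h * tau (bar h) * tau b * tau (- (m * e * h * sg h)))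
      = m * sg (b * D) + tau (m * bar (b * D))"
  unfolding sg_b_D[OF y_forms(1)[OF assms]] tau_m_bar_b_D[OF y_forms(2)[OF assms]]
  using coeff_bar_identity[OF h_bar_h sg_h_bar_h tau_h_bar_h e_e]
  by simp

lemma coeff_id:
  assumes "sg h * b + tau h * bar b = 0"
  shows "m * sg b * sg (e * h * tau (bar h)) + - (m * e * h * sg h) * sg (bar b)
      + tau (bar b) * tau (bar (- (m * e * h * sg h))) + e * h * tau (bar h) * tau b * tau m
      = e * m * sg h * sg (b * D) - e * tau (bar h) * tau (m * bar (b * D))"
  unfolding sg_b_D[OF y_forms(1)[OF assms]] tau_m_bar_b_D[OF y_forms(2)[OF assms]]
  using coeff_id_identity[of m "sg b" e "sg h" "bar h" h "sg (bar b)" "tau (bar b)" "tau m" "tau (bar h)" "tau b"]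
  by simp

text \<open>The four coefficients at \<open>\<sigma>\<^sup>\<plusminus>\<^sup>2\<close> and \<open>\<sigma>\<^sup>\<plusminus>\<^sup>2(x\<^sup>*)\<close> are, up to nonzero factors, images of the same
  element \<open>T\<close> under \<open>\<sigma>\<close> or its inverse, so they give a single equation.\<close>

lemma coeffs_two:
  fixes b :: 'a
  defines "T \<equiv> sg h * b + tau h * bar b"
  shows "sg (sg h) * (m * sg b * sg m + - (m * e * h * sg h) * sg (bar b) * sg (bar (- (m * e * h * sg h))))
      = m * sg m * sg T" (is "?k6")
    and "m * sg b * sg (- (m * e * h * sg h)) + - (m * e * h * sg h) * sg (bar b) * sg (bar m)
      = - m * e * sg m * sg h * sg T" (is "?k7")
    and "tau (tau h) * (tau (bar b) + e * h * tau (bar h) * tau b * tau (e * h * tau (bar h))) = tau T" (is "?k8")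
    and "tau h * (tau (bar b) * tau (bar (e * h * tau (bar h))) + e * h * tau (bar h) * tau b) = tau T" (is "?k9")
proof -
  have s2: "sg (sg h) * sg (sg (bar h)) = e" using sg_h_bar_h by (metis sg.mult sg_e)
  have t2: "tau (tau h) * tau (tau (bar h)) = e" using tau_h_bar_h by (metis tau.mult tau_e)
  have "sg (sg h) * (m * sg b * sg m + - (m * e * h * sg h) * sg (bar b) * sg (bar (- (m * e * h * sg h))))
      = m * sg m * sg (sg h) * sg b
        + m * sg m * h * sg (bar b) * ((e * e) * ((sg h * sg (bar h)) * (sg (sg h) * sg (sg (bar h)))))"
    by (simp add: algebra_simps del: e_e)
  then show ?k6 unfolding s2 sg_h_bar_h T_def by (simp add: algebra_simps)
  show ?k7 unfolding T_def by (simp add: algebra_simps)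
  have "tau (tau h) * (tau (bar b) + e * h * tau (bar h) * tau b * tau (e * h * tau (bar h)))
      = tau (tau h) * tau (bar b)
        + h * tau b * ((e * e) * ((tau h * tau (bar h)) * (tau (tau h) * tau (tau (bar h)))))"
    by (simp add: algebra_simps del: e_e)
  then show ?k8 unfolding t2 tau_h_bar_h T_def by (simp add: algebra_simps)
  have "tau h * (tau (bar b) * tau (bar (e * h * tau (bar h))) + e * h * tau (bar h) * tau b)
     = tau (bar b) * e * tau (tau h) * (tau h * tau (bar h)) + e * h * tau b * (tau h * tau (bar h))"
    by (simp add: algebra_simps del: e_e)
  also have "\<dots> = (e * e) * (tau (bar b) * tau (tau h) + h * tau b)"
    unfolding tau_h_bar_h by (simp only: algebra_simps)
  finally show ?k9 unfolding T_def by (simp add: algebra_simps)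
qed

text \<open>As \<open>D\<close> and \<open>\<sigma>(h)\<close> are nonzero, the equation \<open>T = 0\<close> of the previous lemma says that \<open>b D\<close> has
  trace zero.\<close>

lemma T_times_D: "(sg h * b + tau h * bar b) * D = sg h * (b * D + bar (b * D))"
proof -
  have "tau h * D = sg h * bar D"
    by (simp add: D_def algebra_simps sg_h_bar_h tau_h_bar_h)
  then show ?thesis by (simp add: algebra_simps)
qed

text \<open>If \<open>D = 0\<close> then \<open>h \<sigma>\<^sup>2(h) = - e\<close>, so \<open>\<sigma>\<^sup>2(h) = - h\<^sup>*\<close> and \<open>\<sigma>\<^sup>4(h) = h\<close>. Hence \<open>h\<close> lies in the
  subfield of order \<open>q\<^sup>4\<close>, where \<open>\<sigma>\<^sup>2\<close> is the \<open>q\<^sup>2\<close>-power map and \<open>h\<^sup>*\<close> depends on \<open>t\<close> modulo \<open>4\<close>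
  only. Each residue of \<open>t\<close> leads to \<open>h = - h\<close> or \<open>h\<^sup>* = - h\<^sup>*\<close>, except for \<open>t\<close> odd and
  \<open>q\<close> congruent to 3 modulo 4: there \<open>h\<^sup>2 = -1\<close> and \<open>e = 1\<close>, the pair excluded in the definition of
  admissibility.\<close>

lemma D_nonzero: "D \<noteq> 0"
proof
  assume "D = 0"
  then have "sg h = - tau (bar h)" by (simp add: D_def eq_neg_iff_add_eq_0)
  then have "sg h * tau h = - e" using tau_h_bar_h by (simp add: mult.commute)
  then have "sg (sg h * tau h) = sg (- e)" by (simp only:)
  then have "h * sg (sg h) = h * - bar h" using h_bar_h by (simp add: mult.commute)
  then have sg2: "sg (sg h) = - bar h" by (simp only: mult_cancel_left h_nonzero simp_thms)
  have "sg (sg (sg (sg h))) = sg (sg (- bar h))" unfolding sg2 ..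
  also have "\<dots> = - bar (sg (sg h))" by simp
  also have "\<dots> = h" unfolding sg2 by simp
  finally have sg4: "sg (sg (sg (sg h))) = h" .
  have "h ^ (q ^ (4 * s)) = sg (sg (sg (sg h)))"
    unfolding sg_def power_q_power_q by (rule arg_cong[where f = "\<lambda>k. h ^ (q ^ k)"]) simp
  then have "h ^ (q ^ (4 * s)) = h" using sg4 by simp
  moreover have h2t: "h ^ (q ^ (2 * t)) = h" using power_card_same[of h] card by simp
  ultimately have "h ^ (q ^ gcd (4 * s) (2 * t)) = h" by (rule power_fixed_gcd)
  moreover have "gcd (4 * s) (2 * t) = gcd 4 (2 * t)"
    using coprime_s by (simp add: gcd_mult_left_right_cancel coprime_commute)
  ultimately have hg: "h ^ (q ^ gcd 4 (2 * t)) = h" by simp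
  \<comment> \<open>The greatest common divisor is 2 or 4, and in both cases
    \<open>h\<close> is fixed by the fourth power of \<open>x \<mapsto> x ^ q\<close>.\<close>
  obtain g where g: "4 = gcd 4 (2 * t) * g" using dvdE[OF gcd_dvd1[of 4 "2 * t"]] by blast
  have h4: "h ^ (q ^ (4 * k)) = h" for k
    by (rule iterated_power_fixed) (use iterated_power_fixed[OF hg, of g] g in simp)
  obtain k where k: "s = 2 * k + 1" using odd_s by (elim oddE)
  have "sg (sg h) = h ^ (q ^ (4 * k + 2))"
    unfolding sg_def power_q_power_q by (simp add: k)
  also have "\<dots> = h ^ (q ^ 2)" by (simp only: power_q_power_q[symmetric] h4)
  finally have q2: "h ^ (q ^ 2) = - bar h" using sg2 by simp
  have bar_r: "bar h = h ^ (q ^ (t mod 4))"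
  proof -
    have "bar h = h ^ (q ^ (4 * (t div 4) + t mod 4))" by (simp add: bar_def)
    also have "\<dots> = h ^ (q ^ (t mod 4))" by (simp only: power_q_power_q[symmetric] h4)
    finally show ?thesis .
  qed
  have barh0: "bar h \<noteq> 0" by simp
  show False
  proof (cases "even t")
    case True
    then have "t mod 4 = 0 \<or> t mod 4 = 2" by presburger
    then show False
    proof
      assume "t mod 4 = 0"
      then have bh: "bar h = h" using bar_r by simp
      have "h ^ 4 = (h * h) * (h * h)" by (simp add: power4_eq_xxxx mult.assoc)
      then have h41: "h ^ 4 = 1" using h_bar_h bh by simp
      \<comment> \<open>\<open>h\<close> is a fourth root of unity, and odd squares are 1 modulo 4.\<close>
      obtain j where "q = 2 * j + 1" using odd_q by (elim oddE)
      then have "q ^ 2 = 4 * (j * (j + 1)) + 1" by (simp add: power2_eq_square algebra_simps)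
      then have "h ^ (q ^ 2) = h" by (simp add: power_mult h41 del: mult_Suc mult_Suc_right)
      then show False using q2 bh eq_neg_self_iff[of h] by simp
    next
      assume "t mod 4 = 2"
      then show False using q2 bar_r barh0 eq_neg_self_iff[of "bar h"] by simp
    qed
  next
    case False
    obtain u where u: "t = 2 * u + 1" using False by (elim oddE)
    have "gcd 4 (2 * t) = 2"
    proof -
      have "coprime 2 t" using False by simp
      then show ?thesis using gcd_mult_distrib_nat[of 2 2 t] by (simp add: coprime_iff_gcd_eq_1)
    qed
    then have hq2: "h ^ (q ^ 2) = h" using hg by simp
    then have hb: "bar h = - h" using q2 by (metis minus_minus)
    have hh: "h * h = - e" using h_bar_h hb by (metis minus_minus mult_minus_right)
    have "h ^ 4 = (h * h) * (h * h)" by (simp add: power4_eq_xxxx mult.assoc)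
    then have h41: "h ^ 4 = 1" unfolding hh by simp
    have "bar h = h ^ (q ^ (2 * u + 1))" unfolding bar_def by (subst u) (rule refl)
    also have "\<dots> = h ^ q"
      by (simp only: power_q_power_q[symmetric] iterated_power_fixed[OF hq2] power_one_right)
    also have "\<dots> = h ^ (4 * (q div 4) + q mod 4)" by simp
    also have "\<dots> = h ^ (q mod 4)" by (simp only: power_add power_mult h41 power_one mult_1_left)
    finally have r: "h ^ (q mod 4) = - h" using hb by simp
    have "q mod 4 = 1 \<or> q mod 4 = 3" using odd_q by presburger
    then show False
    proof
      assume "q mod 4 = 1"
      then show False using r eq_neg_self_iff[of h] by simp
    next
      assume q3: "q mod 4 = 3"
      have "h ^ 3 = h * (h * h)" by (simp add: power3_eq_cube mult.assoc)
      then have "h * (h * h) = h * - 1" using r q3 by simp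
      then have "h * h = - 1" by (simp only: mult_cancel_left h_nonzero simp_thms)
      then have "h\<^sup>2 = - 1" and "e = 1" using hh by (auto simp: power2_eq_square)
      then show False using adm False q3 neg_one_ne_one
        unfolding admissible_def e_def by auto
    qed
  qed
qed

section \<open>The equation for the off-diagonal entry\<close>

text \<open>The condition on \<open>y = b D\<close>, where \<open>b\<close> is the upper right entry of a matrix that preserves the
  graph.\<close>

definition stab_offset :: "'a \<Rightarrow> bool" where
  "stab_offset y \<longleftrightarrow> bar y = - y \<and> m * sg y = tau (m * y)"

text \<open>The coefficients at \<open>\<sigma>\<^sup>\<plusminus>\<^sup>1\<close> determine \<open>a\<close> and \<open>d\<close>, those at \<open>\<sigma>\<^sup>\<plusminus>\<^sup>2\<close> say that \<open>b D\<close> has trace zero,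
  and given this the coefficient of \<open>x\<^sup>*\<close> is the second condition on \<open>b D\<close> and the one of \<open>x\<close>
  determines \<open>c\<close>.\<close>

lemma preserves_graph_iff:
  "(\<forall>x. psi_map (a * x + b * psi_map x) = c * x + d * psi_map x) \<longleftrightarrow>
    bar a = a \<and> sg a = tau a \<and> d = sg a \<and> stab_offset (b * D) \<and> c = e * m * sg (b * D) * D"
proof -
  let ?B = "- (m * e * h * sg h)" and ?G = "e * h * tau (bar h)"
  let ?T = "sg h * b + tau h * bar b"
  let ?y = "b * D"
  have nz: "?B \<noteq> 0" "?G \<noteq> 0" by simp_all
  let ?c0 = "m * sg b * sg ?G + ?B * sg (bar b) + tau (bar b) * tau (bar ?B) + ?G * tau b * tau m"
  let ?c1 = "m * sg b + ?B * sg (bar b) * sg (bar ?G) + tau (bar b) * tau (bar m) + ?G * tau b * tau ?B"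
  let ?c6 = "m * sg b * sg m + ?B * sg (bar b) * sg (bar ?B)"
  let ?c7 = "m * sg b * sg ?B + ?B * sg (bar b) * sg (bar m)"
  let ?c8 = "tau (bar b) + ?G * tau b * tau ?G"
  let ?c9 = "tau (bar b) * tau (bar ?G) + ?G * tau b"
  have "(\<forall>x. psi_map (a * x + b * psi_map x) = c * x + d * psi_map x) \<longleftrightarrow>
    ?c0 = c \<and> ?c1 = 0 \<and> m * (sg a - d) = 0 \<and> ?B * (sg (bar a) - d) = 0 \<and> ?G * (tau a - d) = 0
    \<and> tau (bar a) - d = 0 \<and> ?c6 = 0 \<and> ?c7 = 0 \<and> ?c8 = 0 \<and> ?c9 = 0"
    unfolding psi_map_def by (rule quadrinomial_invariance_iff)
  also have "\<dots> \<longleftrightarrow> (sg a = d \<and> sg (bar a) = d \<and> tau a = d \<and> tau (bar a) = d) \<and>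
     (?c6 = 0 \<and> ?c7 = 0 \<and> ?c8 = 0 \<and> ?c9 = 0) \<and> ?c1 = 0 \<and> ?c0 = c"
    using nz by (simp only: mult_eq_0_iff m_nonzero right_minus_eq simp_thms) blast
  also have "(sg a = d \<and> sg (bar a) = d \<and> tau a = d \<and> tau (bar a) = d)
      \<longleftrightarrow> bar a = a \<and> sg a = tau a \<and> d = sg a" by auto
  also have "(?c6 = 0 \<and> ?c7 = 0 \<and> ?c8 = 0 \<and> ?c9 = 0) \<longleftrightarrow> ?T = 0"
  proof
    assume "?c6 = 0 \<and> ?c7 = 0 \<and> ?c8 = 0 \<and> ?c9 = 0"
    then have "tau ?T = 0" using coeffs_two(4)[of b] by (simp only: mult_zero_right)
    then show "?T = 0" by (simp only: tau.eq_zero_iff)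
  next
    assume T: "?T = 0"
    have "sg (sg h) * ?c6 = 0" "?c7 = 0" "tau (tau h) * ?c8 = 0" "tau h * ?c9 = 0"
      unfolding coeffs_two T by simp_all
    then show "?c6 = 0 \<and> ?c7 = 0 \<and> ?c8 = 0 \<and> ?c9 = 0"
      by (simp only: mult_eq_0_iff sg.eq_zero_iff tau.eq_zero_iff h_nonzero simp_thms)
  qed
  also have "?T = 0 \<longleftrightarrow> bar ?y = - ?y"
  proof -
    have "?T = 0 \<longleftrightarrow> ?T * D = 0" using D_nonzero by simp
    also have "\<dots> \<longleftrightarrow> ?y + bar ?y = 0" unfolding T_times_D by simp
    also have "\<dots> \<longleftrightarrow> bar ?y = - ?y" by (metis add.commute eq_neg_iff_add_eq_0)
    finally show ?thesis .
  qed
  also have "(bar a = a \<and> sg a = tau a \<and> d = sg a) \<and> bar ?y = - ?y \<and> ?c1 = 0 \<and> ?c0 = c \<longleftrightarrow>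
    (bar a = a \<and> sg a = tau a \<and> d = sg a) \<and> bar ?y = - ?y \<and> m * sg ?y = tau (m * ?y) \<and> c = e * m * sg ?y * D"
  proof -
    have "?c1 = 0 \<and> ?c0 = c \<longleftrightarrow> m * sg ?y = tau (m * ?y) \<and> c = e * m * sg ?y * D"
      if y: "bar ?y = - ?y"
    proof -
      have "?T * D = 0" unfolding T_times_D y by simp
      then have T: "?T = 0" using D_nonzero by simp
      have my: "m * bar ?y = - (m * ?y)" unfolding y by simp
      have "?c1 = 0 \<longleftrightarrow> bar h * ?c1 = 0"
        by (simp only: mult_eq_0_iff bar.eq_zero_iff h_nonzero simp_thms)
      also have "\<dots> \<longleftrightarrow> m * sg ?y = tau (m * ?y)"
        unfolding coeff_bar[OF T] my by (simp only: tau.minus add_uminus_conv_diff right_minus_eq)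
      finally have c1: "?c1 = 0 \<longleftrightarrow> m * sg ?y = tau (m * ?y)" .
      have "?c0 = e * m * sg ?y * D" if c: "m * sg ?y = tau (m * ?y)"
      proof -
        have "?c0 = e * m * sg h * sg ?y + e * tau (bar h) * (m * sg ?y)"
          unfolding coeff_id[OF T] my c by (simp only: tau.minus mult_minus_right diff_minus_eq_add)
        also have "\<dots> = e * m * sg ?y * (sg h + tau (bar h))"
          by (simp only: distrib_left mult_ac)
        also have "\<dots> = e * m * sg ?y * D" by (simp only: D_def)
        finally show ?thesis .
      qed
      then show ?thesis using c1 by blast
    qed
    then show ?thesis by blast
  qed
  finally show ?thesis unfolding stab_offset_def by blast
qed

lemma stab_offset_twice: "stab_offset y \<Longrightarrow> sg m * sg (sg y) = m * y"
  unfolding stab_offset_def by (metis sg.mult sg_tau)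

end

lemma minus_one_dvd_power_minus_one: "(x::nat) - 1 dvd x ^ n - 1"
proof (cases "x = 0")
  case False
  show ?thesis
  proof (induction n)
    case (Suc n)
    have "x ^ Suc n - 1 = x * (x ^ n - 1) + (x - 1)"
      using False by (simp add: diff_mult_distrib2)
    then show ?case using Suc by simp
  qed simp
qed (cases n; simp)

context galois_field
begin

lemma sg_sg_fixed_iff: "sg (sg x) = x \<longleftrightarrow> x \<in> subfld (q ^ 2)"
proof
  assume "sg (sg x) = x"
  then have "x ^ (q ^ (2 * s)) = x" by (simp add: sg_def power_q_power_q mult_2)
  then have "x ^ (q ^ gcd (2 * s) (2 * t)) = x"
    by (rule power_fixed_gcd) (simp add: power_card_same flip: card)
  moreover have "gcd (2 * s) (2 * t) = 2"
    using coprime_s gcd_mult_distrib_nat[of 2 s t] by simp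
  ultimately show "x \<in> subfld (q ^ 2)" by (simp add: subfld_def)
next
  assume "x \<in> subfld (q ^ 2)"
  then show "sg (sg x) = x" using iterated_power_fixed[of x q 2 s]
    by (simp add: subfld_def sg_def power_q_power_q mult_2)
qed

lemma subfld_square_odd_power:
  fixes x :: 'a
  assumes "x \<in> subfld (q ^ 2)" and "odd k"
  shows "x ^ (q ^ k) = x ^ q"
proof -
  obtain j where j: "k = 2 * j + 1" using assms(2) by (elim oddE)
  have "x ^ (q ^ k) = (x ^ (q ^ (2 * j))) ^ (q ^ 1)" unfolding j by (simp only: power_q_power_q)
  also have "x ^ (q ^ (2 * j)) = x" by (rule iterated_power_fixed) (use assms in \<open>simp add: subfld_def\<close>)
  finally show ?thesis by simp
qed

lemma bar_fixed_if_even: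
  assumes "x \<in> subfld (q ^ 2)" and "even t"
  shows "bar x = x"
proof -
  obtain j where j: "t = 2 * j" using assms(2) by (elim evenE)
  show ?thesis unfolding bar_def
    by (subst j, rule iterated_power_fixed) (use assms in \<open>simp add: subfld_def\<close>)
qed

lemma bar_eq_sg_if_odd:
  assumes "x \<in> subfld (q ^ 2)" and "odd t"
  shows "bar x = sg x"
  unfolding bar_def sg_def using subfld_square_odd_power[OF assms(1)] assms(2) odd_s by simp

lemma subfld_q_subset: "x \<in> subfld q \<Longrightarrow> x \<in> subfld (q ^ 2)"
  using iterated_power_fixed[of x q 1 2] by (simp add: subfld_def)

lemma sg_fixed_iff: "sg x = x \<longleftrightarrow> x \<in> subfld q"
proof
  assume "sg x = x"
  then have "x ^ (q ^ gcd s (2 * t)) = x"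
    by (intro power_fixed_gcd) (simp_all add: sg_def power_card_same flip: card)
  then show "x \<in> subfld q" using coprime_s by (simp add: subfld_def)
next
  assume "x \<in> subfld q"
  then show "sg x = x" using iterated_power_fixed[of x q 1 s] by (simp add: subfld_def sg_def)
qed

lemma bar_fixed_if_subfld_q: "x \<in> subfld q \<Longrightarrow> bar x = x"
  using iterated_power_fixed[of x q 1 t] by (simp add: subfld_def bar_def)

lemma diagonal_fixed_iff:
  "bar a = a \<and> sg a = tau a \<longleftrightarrow> a \<in> subfld (if even t then q ^ 2 else q)"
proof -
  have "sg a = tau a \<longleftrightarrow> sg (sg a) = a"
    by (metis sg_tau tau_sg)
  moreover have "bar a = a \<and> a \<in> subfld (q ^ 2) \<longleftrightarrow> a \<in> subfld q" if "odd t"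
  proof
    assume *: "bar a = a \<and> a \<in> subfld (q ^ 2)"
    then have "sg a = a" using bar_eq_sg_if_odd that by metis
    then show "a \<in> subfld q" by (simp only: sg_fixed_iff)
  qed (simp add: bar_fixed_if_subfld_q subfld_q_subset)
  ultimately show ?thesis using bar_fixed_if_even by (auto simp: sg_sg_fixed_iff)
qed

lemma square_eq_one_mod_4: "4 dvd q ^ 2 - 1"
proof -
  obtain j where "q = 2 * j + 1" using odd_q by (elim oddE)
  then have "q ^ 2 - 1 = 4 * (j * (j + 1))" by (simp add: power2_eq_square algebra_simps)
  then show ?thesis by simp
qed

lemma card_minus_one: obtains f where "CARD('a) - 1 = (q ^ 2 - 1) * f"
proof -
  have "q ^ 2 - 1 dvd (q ^ 2) ^ t - 1" by (rule minus_one_dvd_power_minus_one)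
  then show ?thesis using that unfolding card power_mult by blast
qed

lemma subfld_q_power_minus_one:
  fixes x :: 'a
  assumes "x \<in> subfld q" and "x \<noteq> 0"
  shows "x ^ (q - 1) = 1"
proof -
  have "x ^ (q - 1) * x = x ^ q" using q_gt_1 by (simp flip: power_Suc2)
  then show ?thesis using assms by (simp add: subfld_def)
qed

text \<open>Roots of \<open>k ^ (q + 1) = x\<close> exist in the ambient field by the count of power residues, and any of
  them satisfies \<open>k ^ (q\<^sup>2 - 1) = x ^ (q - 1) = 1\<close>. On the subfield of order \<open>q\<^sup>2\<close> the map \<open>\<sigma>\<close> is
  \<open>k \<mapsto> k ^ q\<close> because \<open>s\<close> is odd.\<close>

lemma norm_surjective:
  fixes x :: 'a
  assumes "x \<in> subfld q" and "x \<noteq> 0"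
  obtains k where "k \<in> subfld (q ^ 2)" and "k * sg k = x"
proof -
  obtain f where f: "CARD('a) - 1 = (q ^ 2 - 1) * f" by (rule card_minus_one)
  have q2: "q ^ 2 - 1 = (q + 1) * (q - 1)"
    by (simp add: power2_eq_square diff_mult_distrib2)
  have x1: "x ^ (q - 1) = 1" using subfld_q_power_minus_one[OF assms] .
  have "(q + 1) * ((q - 1) * f) = CARD('a) - 1" unfolding f q2 by (simp only: mult.assoc)
  moreover have "x ^ ((q - 1) * f) = 1" by (simp only: power_mult x1 power_one)
  ultimately obtain k where k: "k ^ (q + 1) = x" by (rule power_eq_one_imp_power_residue)
  have "k ^ (q ^ 2 - 1) = 1" unfolding q2 power_mult k by (rule x1)
  then have "k ^ (q ^ 2 - 1) * k = k" by simp
  then have "k ^ (q ^ 2) = k" using q_gt_1 by (simp flip: power_Suc2)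
  then have k2: "k \<in> subfld (q ^ 2)" by (simp add: subfld_def)
  have "k * sg k = k ^ (q + 1)"
    unfolding sg_def using subfld_square_odd_power[OF k2 odd_s] by simp
  then have "k * sg k = x" unfolding k .
  then show ?thesis using k2 that by blast
qed

lemma square_root_of_minus_one_in_subfld:
  assumes i: "(i::'a) * i = - 1"
  shows "i \<in> subfld q \<longleftrightarrow> q mod 4 = 1"
proof -
  have "i ^ 4 = (i * i) * (i * i)" by (simp add: power4_eq_xxxx mult.assoc)
  then have i4: "i ^ 4 = 1" using i by simp
  have "i ^ q = i ^ (4 * (q div 4) + q mod 4)" by simp
  also have "\<dots> = i ^ (q mod 4)" by (simp only: power_add power_mult i4 power_one mult_1_left)
  finally have iq: "i ^ q = i ^ (q mod 4)" .
  have i3: "i ^ 3 = - i" using i by (simp add: power3_eq_cube)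
  have i0: "i \<noteq> 0" using i by auto
  have "q mod 4 = 1 \<or> q mod 4 = 3" using odd_q by presburger
  then show ?thesis
    using iq i3 i0 eq_neg_self_iff[of i] unfolding subfld_def by (elim disjE) auto
qed

lemma square_root_of_minus_one_exists: obtains i where "(i::'a) * i = - 1"
proof -
  obtain f where f: "CARD('a) - 1 = (q ^ 2 - 1) * f" by (rule card_minus_one)
  obtain g where g: "q ^ 2 - 1 = 4 * g" using square_eq_one_mod_4 by blast
  have "2 * (2 * (g * f)) = CARD('a) - 1" unfolding f g by simp
  moreover have "(- 1 :: 'a) ^ (2 * (g * f)) = 1" by simp
  ultimately obtain i :: 'a where "i ^ 2 = - 1" by (rule power_eq_one_imp_power_residue)
  then show ?thesis using that by (simp add: power2_eq_square)
qed

lemma P_plus_memI: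
  assumes "bar w = - w"
  shows "w * sg w \<in> P_plus q t s"
proof -
  have "w ^ (q ^ s + 1) = w * sg w" by (simp add: sg_def)
  moreover have "rel_trace q t w = 0" using assms by (simp add: rel_trace_def bar_def)
  ultimately show ?thesis unfolding P_plus_def by force
qed

end

context psi_field
begin

text \<open>The element is fixed by \<open>\<sigma>\<close>, because the second condition on \<open>y\<close> reads
  \<open>\<sigma>(m) \<sigma>\<^sup>2(y) = m y\<close> after applying \<open>\<sigma>\<close>.\<close>

lemma stab_offset_lambda:
  assumes "stab_offset y"
  shows "m * y * sg y \<in> subfld q"
proof -
  have "sg (m * y * sg y) = (sg m * sg (sg y)) * sg y" by (simp add: mult_ac)
  also have "\<dots> = m * y * sg y" unfolding stab_offset_twice[OF assms] ..
  finally show ?thesis by (simp only: sg_fixed_iff)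
qed

text \<open>Here \<open>m = (k / y) \<sigma>(k / y)\<close>, and \<open>k / y\<close> has trace zero.\<close>

lemma P_plus_if_offset:
  assumes y: "stab_offset y" "y \<noteq> 0" and k: "bar k = k" "k * sg k = m * y * sg y"
  shows "m \<in> P_plus q t s"
proof -
  have "bar (k / y) = - (k / y)" using y(1) k(1) by (simp add: stab_offset_def)
  then have "k / y * sg (k / y) \<in> P_plus q t s" by (rule P_plus_memI)
  also have "k / y * sg (k / y) = m * y * sg y / (y * sg y)" by (simp flip: k(2))
  also have "\<dots> = m" using y(2) by simp
  finally show ?thesis .
qed

lemma stab_offset_zero: "stab_offset 0"
  by (simp add: stab_offset_def)

lemma stab_offset_even:
  assumes "even t" and y: "stab_offset y"
  shows "y = 0"
proof (rule ccontr)
  assume y0: "y \<noteq> 0"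
  then have "m * y * sg y \<noteq> 0" by simp
  then obtain k where k: "k \<in> subfld (q ^ 2)" "k * sg k = m * y * sg y"
    using norm_surjective[OF stab_offset_lambda[OF y]] by blast
  then have "m \<in> P_plus q t s"
    using P_plus_if_offset[OF y y0] bar_fixed_if_even assms(1) by blast
  then show False using adm assms(1) unfolding admissible_def by auto
qed

text \<open>If \<open>m\<close> is not in \<open>P_plus\<close>, then \<open>\<lambda> = m y \<sigma>(y)\<close> is a nonsquare in the subfield of order \<open>q\<close>; a
  sign \<open>e = -1\<close> can occur together with this only if \<open>q\<close> is 1 modulo 4, where \<open>-1\<close> is a square. If
  \<open>m = v \<sigma>(v)\<close> is in \<open>P_plus\<close>, then \<open>\<lambda>\<close> is the square of \<open>v y\<close>, which lies in the subfield; but then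
  \<open>q\<close> is 3 modulo 4 and \<open>e = -1\<close> is a nonsquare.\<close>

lemma stab_offset_nonsquare:
  assumes t: "odd t" and y: "stab_offset y" "y \<noteq> 0" and z: "z \<in> subfld q"
  shows "z * z \<noteq> e * (m * y * sg y)"
proof
  assume zz: "z * z = e * (m * y * sg y)"
  have lam: "m * y * sg y = e * (z * z)" unfolding zz by (simp flip: mult.assoc)
  have not_sq: False if "m \<notin> P_plus q t s" "k \<in> subfld q" "k * k = m * y * sg y" for k
  proof -
    have "sg k = k" "bar k = k" using that(2) sg_fixed_iff bar_fixed_if_subfld_q by auto
    then show False using P_plus_if_offset[OF y, of k] that by simp
  qed
  from adm t consider "m \<notin> P_plus q t s" "e = 1"
    | "m \<notin> P_plus q t s" "q mod 4 = 1" "e = - 1"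
    | "m \<in> P_plus q t s" "q mod 4 = 3" "e = - 1"
    unfolding admissible_def e_def by auto
  then show False
  proof cases
    case 1
    then show False using not_sq z zz by simp
  next
    case 2
    obtain i :: 'a where i: "i * i = - 1" by (rule square_root_of_minus_one_exists)
    have "i \<in> subfld q" using square_root_of_minus_one_in_subfld[OF i] 2 by simp
    then have "i * z \<in> subfld q" using z by (simp add: subfld_def power_mult_distrib)
    moreover have "(i * z) * (i * z) = (i * i) * (z * z)" by (simp only: mult_ac)
    ultimately show False using not_sq[of "i * z"] 2 lam i by simp
  next
    case 3
    then obtain v where v: "m = v ^ (q ^ s + 1)" "rel_trace q t v = 0" by (auto simp: P_plus_def)
    have mv: "m = v * sg v" using v(1) by (simp add: sg_def)
    have "bar v = - v" using v(2) by (simp add: rel_trace_def bar_def eq_neg_iff_add_eq_0 add.commute)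
    then have bu: "bar (v * y) = v * y" using y(1) by (simp add: stab_offset_def)
    have u0: "v * y \<noteq> 0" using mv y(2) m_nonzero by auto
    have lu: "m * y * sg y = v * y * sg (v * y)" unfolding mv by (simp add: mult_ac)
    have "sg (v * y * sg (v * y)) = v * y * sg (v * y)"
      using stab_offset_lambda[OF y(1)] unfolding lu sg_fixed_iff .
    then have "sg (v * y) * sg (sg (v * y)) = sg (v * y) * (v * y)"
      by (simp only: sg.mult[of "v * y"] mult.commute)
    then have "sg (sg (v * y)) = v * y"
      using u0 by (simp only: mult_cancel_left sg.eq_zero_iff simp_thms)
    then have "v * y \<in> subfld (q ^ 2)" by (simp only: sg_sg_fixed_iff)
    then have su: "sg (v * y) = v * y" using bar_eq_sg_if_odd t bu by metis
    then have uq: "v * y \<in> subfld q" by (simp only: sg_fixed_iff)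
    have zz': "z * z = - ((v * y) * (v * y))" using zz 3 unfolding lu su by simp
    have "z / (v * y) * (z / (v * y)) = - 1"
      using u0 by (simp only: times_divide_times_eq zz' minus_divide_left[symmetric] divide_self mult_eq_0_iff simp_thms)
    moreover have "z / (v * y) \<in> subfld q" using z uq by (simp add: subfld_def power_divide)
    ultimately show False using square_root_of_minus_one_in_subfld 3 by fastforce
  qed
qed

text \<open>For odd \<open>t\<close> the exponent is such that \<open>\<sigma>\<^sup>2\<close> multiplies \<open>m\<^sup>R\<close> by \<open>m / \<sigma>(m)\<close>: as \<open>R (q ^ (2 s) - 1)\<close> equals
  \<open>1 - q ^ (s (t + 1))\<close>, the factor is \<open>m / \<sigma>(m\<^sup>*)\<close>, and \<open>m\<^sup>* = m\<close>. So \<open>m\<^sup>R\<close> solves the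
  homogeneous equation \<open>\<sigma>(m) \<sigma>\<^sup>2(y) = m y\<close>.\<close>

definition m_pow_R :: 'a where "m_pow_R = m powi R_exp q t s"

lemma m_pow_R_nonzero [simp]: "m_pow_R \<noteq> 0"
  by (simp add: m_pow_R_def)

lemma m_pow_R_facts:
  assumes "odd t"
  shows "bar m_pow_R = m_pow_R" and "sg m * sg (sg m_pow_R) = m * m_pow_R"
proof -
  obtain u where u: "t + 1 = 2 * u" using assms by (metis odd_even_add odd_one evenE)
  have pw: "q ^ (s * (t + 1)) = (q ^ (2 * s)) ^ u" unfolding u by (simp flip: power_mult add: mult_ac)
  obtain E where E: "q ^ (s * (t + 1)) - 1 = (q ^ (2 * s) - 1) * E"
    unfolding pw using minus_one_dvd_power_minus_one by blast
  have "s > 0" using odd_s by (cases s) auto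
  then have gt: "q ^ (2 * s) > 1" using q_gt_1 by (intro one_less_power) auto
  have ge: "q ^ k \<ge> 1" for k using q_gt_1 by simp
  have nz: "int q ^ (2 * s) - 1 \<noteq> 0"
    using gt by (metis eq_iff_diff_eq_0 less_irrefl of_nat_1_eq_iff of_nat_power)
  have "int q ^ (s * (t + 1)) - 1 = int (q ^ (s * (t + 1)) - 1)"
    using ge by (simp add: of_nat_diff)
  also have "\<dots> = (int q ^ (2 * s) - 1) * int E"
    unfolding E using ge by (simp add: of_nat_diff)
  finally have R: "R_exp q t s = - int E"
    unfolding R_exp_def by (simp only: nonzero_mult_div_cancel_left[OF nz])
  have m_pow_R: "m_pow_R = inverse (m ^ E)" by (simp add: m_pow_R_def R power_int_minus)
  show "bar m_pow_R = m_pow_R" unfolding m_pow_R by simp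
  have "E * q ^ (2 * s) + 1 = E * (q ^ (2 * s) - 1) + (E + 1)"
    using gt by (simp add: diff_mult_distrib2)
  also have "\<dots> = E + q ^ (s * (t + 1))" using E ge[of "s * (t + 1)"] by (simp add: mult.commute)
  finally have ex: "E * q ^ (2 * s) + 1 = E + q ^ (s * (t + 1))" .
  have "sg (sg (m ^ E)) = m ^ (E * q ^ (2 * s))"
    unfolding sg_def power_q_power_q by (simp add: power_mult mult_2)
  then have "sg (sg (m ^ E)) * m = m ^ (E * q ^ (2 * s) + 1)" by simp
  also have "\<dots> = m ^ E * sg m" unfolding ex power_add power_t_plus_1 by simp
  finally have "sg (sg (m ^ E)) * m = m ^ E * sg m" .
  then show "sg m * sg (sg m_pow_R) = m * m_pow_R" unfolding m_pow_R by (simp add: field_simps)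
qed

lemma tau_m_m_pow_R: "odd t \<Longrightarrow> tau (m * m_pow_R) = m * sg m_pow_R"
  using m_pow_R_facts(2) by (metis sg.mult tau_sg)

text \<open>Nonzero solutions of \<open>\<sigma>(m) \<sigma>\<^sup>2(y) = m y\<close> differ by a factor fixed by \<open>\<sigma>\<^sup>2\<close>. On such factors \<open>bar\<close> and
  \<open>\<sigma>\<close> agree for \<open>t\<close> odd, so trace zero becomes \<open>\<sigma>(\<xi>) = - \<xi>\<close>.\<close>

lemma stab_offset_odd_iff:
  assumes t: "odd t"
  shows "stab_offset y \<longleftrightarrow> (\<exists>\<xi>\<in>subfld (q ^ 2). sg \<xi> + \<xi> = 0 \<and> y = \<xi> * m_pow_R)"
proof
  assume y: "stab_offset y"
  define x where "x = y / m_pow_R"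
  have y_x: "y = x * m_pow_R" by (simp add: x_def)
  have "(sg m * sg (sg m_pow_R)) * sg (sg x) = sg m * sg (sg y)"
    unfolding y_x by (simp add: mult_ac)
  also have "\<dots> = (m * m_pow_R) * x" using stab_offset_twice[OF y] by (simp add: y_x mult_ac)
  finally have "(m * m_pow_R) * sg (sg x) = (m * m_pow_R) * x" unfolding m_pow_R_facts(2)[OF t] .
  then have "sg (sg x) = x" by simp
  then have x2: "x \<in> subfld (q ^ 2)" by (simp only: sg_sg_fixed_iff)
  have "bar x = - x" using y by (simp add: x_def stab_offset_def m_pow_R_facts(1)[OF t])
  then have "sg x + x = 0" using bar_eq_sg_if_odd[OF x2 t] by simp
  then show "\<exists>\<xi>\<in>subfld (q ^ 2). sg \<xi> + \<xi> = 0 \<and> y = \<xi> * m_pow_R" using x2 y_x by blast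
next
  assume "\<exists>\<xi>\<in>subfld (q ^ 2). sg \<xi> + \<xi> = 0 \<and> y = \<xi> * m_pow_R"
  then obtain x where x: "x \<in> subfld (q ^ 2)" "sg x + x = 0" "y = x * m_pow_R" by blast
  have sx: "sg x = - x" using x(2) by (simp add: eq_neg_iff_add_eq_0)
  have bx: "bar x = - x" using bar_eq_sg_if_odd[OF x(1) t] sx by simp
  have "tau (- x) = x" using sx by (metis tau_sg)
  then have tx: "tau x = - x" by (simp add: equation_minus_iff)
  have "tau (m * y) = tau x * tau (m * m_pow_R)" unfolding x(3) by (simp add: mult_ac)
  also have "\<dots> = m * sg y" unfolding tau_m_m_pow_R[OF t] tx x(3) by (simp add: sx)
  finally show "stab_offset y" unfolding stab_offset_def
    using x(3) by (simp add: bx m_pow_R_facts(1)[OF t])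
qed

end

section \<open>The stabiliser of the graph\<close>

lemma mat22_vector: "mat22 a b c d *v vector [x, y] = vector [a * x + b * y, c * x + d * y]"
  by (simp add: vec_eq_iff forall_2 matrix_vector_mult_def sum_2 mat22_def)

lemma mat22_cases: obtains a b c d where "A = mat22 a b c d"
proof
  show "A = mat22 (A $ 1 $ 1) (A $ 1 $ 2) (A $ 2 $ 1) (A $ 2 $ 2)"
    by (simp add: vec_eq_iff forall_2 mat22_def)
qed

lemma mat22_zero: "mat22 0 0 0 0 = 0"
  by (simp add: vec_eq_iff forall_2 mat22_def)

lemma mat22_eq_iff: "mat22 a b c d = mat22 a' b' c' d' \<longleftrightarrow> a = a' \<and> b = b' \<and> c = c' \<and> d = d'"
  by (auto simp: vec_eq_iff forall_2 mat22_def)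

lemma invertible_mat22_iff: "invertible (mat22 a b c d) \<longleftrightarrow> a * d - b * c \<noteq> 0"
  by (simp add: invertible_det_nz det_2 mat22_def)

text \<open>The graph is finite and an invertible matrix acts injectively, so mapping the graph into itself
  is enough.\<close>

lemma stab_iff:
  "mat22 a b c d \<in> stab f \<longleftrightarrow> a * d - b * c \<noteq> 0 \<and>
    (\<forall>x. poly f (a * x + b * poly f x) = c * x + d * poly f x)"
proof -
  let ?A = "mat22 a b c d"
  have graph: "graph_set f = range (\<lambda>x. vector [x, poly f x])"
    unfolding graph_set_def by auto
  have mem: "vector [u, v] \<in> graph_set f \<longleftrightarrow> v = poly f u" for u v
    unfolding graph_set_def by (auto simp: vec_eq_iff forall_2)
  have sub: "(\<lambda>v. ?A *v v) ` graph_set f \<subseteq> graph_set f \<longleftrightarrow>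
      (\<forall>x. poly f (a * x + b * poly f x) = c * x + d * poly f x)"
  proof -
    have "(\<lambda>v. ?A *v v) ` graph_set f \<subseteq> graph_set f \<longleftrightarrow>
        (\<forall>x. ?A *v vector [x, poly f x] \<in> graph_set f)"
      unfolding graph[THEN arg_cong[where f = "\<lambda>S. (\<lambda>v. ?A *v v) ` S"]] by auto
    then show ?thesis unfolding mat22_vector mem by metis
  qed
  have "(\<lambda>v. ?A *v v) ` graph_set f = graph_set f"
    if "invertible ?A" "(\<lambda>v. ?A *v v) ` graph_set f \<subseteq> graph_set f"
  proof (rule endo_inj_surj)
    show "finite (graph_set f)" unfolding graph by simp
    show "inj_on (\<lambda>v. ?A *v v) (graph_set f)"
      using inj_matrix_vector_mult[OF that(1)] by (rule inj_on_subset) simp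
  qed (rule that(2))
  then show ?thesis
    unfolding stab_def mem_Collect_eq sub[symmetric] invertible_mat22_iff by blast
qed

context psi_field
begin

lemma stab0_iff:
  "mat22 a b c d \<in> stab0 (psi q t m h s) \<longleftrightarrow>
    (a = 0 \<and> b = 0 \<and> c = 0 \<and> d = 0) \<or> (a * d - b * c \<noteq> 0 \<and>
    a \<in> subfld (if even t then q ^ 2 else q) \<and> d = sg a \<and>
    stab_offset (b * D) \<and> c = e * m * sg (b * D) * D)"
  unfolding stab0_def Un_iff stab_iff poly_psi preserves_graph_iff singleton_iff
    mat22_zero[symmetric] mat22_eq_iff
  using diagonal_fixed_iff[of a] by blast

lemma stab0_even:
  assumes t: "even t"
  shows "stab0 (psi q t m h s) = {mat22 \<alpha> 0 0 (\<alpha> ^ (q ^ s)) | \<alpha>. \<alpha> \<in> subfld (q ^ 2)}"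
proof (intro equalityI subsetI)
  fix A assume A: "A \<in> stab0 (psi q t m h s)"
  obtain a b c d where abcd: "A = mat22 a b c d" by (rule mat22_cases)
  have "0 \<in> subfld (q ^ 2)" using q_gt_1 by (simp add: subfld_def)
  moreover have "b = 0" if "stab_offset (b * D)"
    using stab_offset_even[OF t that] D_nonzero by simp
  ultimately have "b = 0 \<and> c = 0 \<and> d = sg a \<and> a \<in> subfld (q ^ 2)"
    using A t unfolding abcd stab0_iff by auto
  then show "A \<in> {mat22 \<alpha> 0 0 (\<alpha> ^ (q ^ s)) | \<alpha>. \<alpha> \<in> subfld (q ^ 2)}"
    unfolding abcd sg_def by blast
next
  fix A :: "'a^2^2" assume "A \<in> {mat22 \<alpha> 0 0 (\<alpha> ^ (q ^ s)) | \<alpha>. \<alpha> \<in> subfld (q ^ 2)}"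
  then obtain a where "A = mat22 a 0 0 (sg a)" "a \<in> subfld (q ^ 2)" unfolding sg_def by blast
  then show "A \<in> stab0 (psi q t m h s)"
    unfolding \<open>A = _\<close> stab0_iff using t stab_offset_zero by auto
qed

text \<open>The determinant is \<open>a\<^sup>2 - e \<lambda>\<close> with \<open>\<lambda> = m y \<sigma>(y)\<close>, \<open>y = b D\<close>.\<close>

lemma determinant_nonzero:
  assumes t: "odd t" and a: "a \<in> subfld q" and y: "stab_offset (b * D)" and nz: "a \<noteq> 0 \<or> b \<noteq> 0"
  shows "a * sg a - b * (e * m * sg (b * D) * D) \<noteq> 0"
proof
  assume "a * sg a - b * (e * m * sg (b * D) * D) = 0"
  moreover have "sg a = a" using a by (simp only: sg_fixed_iff)
  ultimately have eq: "a * a = e * (m * (b * D) * sg (b * D))" by (simp add: mult_ac)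
  show False
  proof (cases "b = 0")
    case True
    then show False using eq nz by simp
  next
    case False
    then show False using stab_offset_nonsquare[OF t y _ a] eq D_nonzero by simp
  qed
qed

lemma stab0_odd_iff:
  assumes t: "odd t"
  shows "mat22 a b c d \<in> stab0 (psi q t m h s) \<longleftrightarrow>
    a \<in> subfld q \<and> d = a \<and> stab_offset (b * D) \<and> c = e * m * sg (b * D) * D"
proof -
  have 0: "0 \<in> subfld q" using q_gt_1 by (simp add: subfld_def)
  show ?thesis
  proof
    assume "mat22 a b c d \<in> stab0 (psi q t m h s)"
    then have "a = 0 \<and> b = 0 \<and> c = 0 \<and> d = 0 \<or> a \<in> subfld q \<and> d = sg a \<and> stab_offset (b * D)
        \<and> c = e * m * sg (b * D) * D"
      unfolding stab0_iff using t by (simp only: if_False) blast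
    then show "a \<in> subfld q \<and> d = a \<and> stab_offset (b * D) \<and> c = e * m * sg (b * D) * D"
    proof
      assume "a = 0 \<and> b = 0 \<and> c = 0 \<and> d = 0"
      then show ?thesis using 0 stab_offset_zero by simp
    next
      assume *: "a \<in> subfld q \<and> d = sg a \<and> stab_offset (b * D) \<and> c = e * m * sg (b * D) * D"
      then have "sg a = a" by (simp only: sg_fixed_iff)
      then show ?thesis using * by metis
    qed
  next
    assume *: "a \<in> subfld q \<and> d = a \<and> stab_offset (b * D) \<and> c = e * m * sg (b * D) * D"
    then have sa: "sg a = a" by (simp only: sg_fixed_iff)
    show "mat22 a b c d \<in> stab0 (psi q t m h s)"
    proof (cases "a = 0 \<and> b = 0")
      case True
      then show ?thesis unfolding stab0_iff using * by simp
    next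
      case False
      then have "a * sg a - b * (e * m * sg (b * D) * D) \<noteq> 0"
        using determinant_nonzero[OF t, of a b] * by blast
      then show ?thesis unfolding stab0_iff using * t sa by metis
    qed
  qed
qed

lemma D_eq: "D = h ^ (q ^ s) + h ^ (q ^ (s * (t - 1)))"
  unfolding D_def power_t_minus_1 sg_def ..

lemma m_pow_R_powi_1: "m powi (R_exp q t s * int q ^ s + 1) = m * sg m_pow_R"
proof -
  have "int q ^ s = int (q ^ s)" by simp
  then have "m powi (R_exp q t s * int q ^ s + 1) = m powi (R_exp q t s * int (q ^ s)) * m"
    by (simp only: power_int_add_1 m_nonzero simp_thms)
  also have "\<dots> = sg m_pow_R * m" by (simp only: power_int_mult power_int_of_nat m_pow_R_def sg_def)
  finally show ?thesis by (simp only: mult.commute)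
qed

lemma m_pow_R_powi_2:
  assumes t: "odd t"
  shows "m powi (int q ^ (s * (t - 1)) * (R_exp q t s + 1)) = m * sg m_pow_R"
proof -
  have "int q ^ (s * (t - 1)) = int (q ^ (s * (t - 1)))" by simp
  then have "m powi (int q ^ (s * (t - 1)) * (R_exp q t s + 1))
      = (m powi (R_exp q t s + 1)) ^ (q ^ (s * (t - 1)))"
    by (simp only: power_int_mult power_int_of_nat mult.commute)
  also have "m powi (R_exp q t s + 1) = m_pow_R * m"
    by (simp only: power_int_add_1 m_nonzero simp_thms m_pow_R_def)
  also have "(m_pow_R * m) ^ (q ^ (s * (t - 1))) = tau (m * m_pow_R)"
    unfolding power_t_minus_1 by (simp add: m_pow_R_facts(1)[OF t] mult.commute)
  finally show ?thesis unfolding tau_m_m_pow_R[OF t] .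
qed

lemma stab0_odd:
  assumes t: "odd t"
  shows "stab0 (psi q t m h s) =
    {mat22 \<alpha>
       (\<xi> * (m powi R_exp q t s / (h ^ (q ^ s) + h ^ (q ^ (s * (t - 1))))))
       (- \<xi> * rel_norm q t h *
          (m powi (R_exp q t s * int q ^ s + 1) * h ^ (q ^ s)
           + m powi (int q ^ (s * (t - 1)) * (R_exp q t s + 1))
               * h ^ (q ^ (s * (t - 1)))))
       \<alpha>
     | \<alpha> \<xi>. \<alpha> \<in> subfld q \<and> \<xi> \<in> subfld (q ^ 2) \<and> \<xi> ^ (q ^ s) + \<xi> = 0}"
    (is "_ = ?S")
proof -
  have c: "- \<xi> * rel_norm q t h * (m powi (R_exp q t s * int q ^ s + 1) * h ^ (q ^ s)
           + m powi (int q ^ (s * (t - 1)) * (R_exp q t s + 1)) * h ^ (q ^ (s * (t - 1))))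
    = e * m * sg (\<xi> * m_pow_R) * D" if "\<xi> ^ (q ^ s) + \<xi> = 0" for \<xi>
  proof -
    have sx: "sg \<xi> = - \<xi>" using that by (simp add: eq_neg_iff_add_eq_0 sg_def)
    have "(- \<xi>) * e * (m * sg m_pow_R * u + m * sg m_pow_R * v) = e * m * (- \<xi> * sg m_pow_R) * (u + v)" for u v
      by (simp add: algebra_simps)
    then show ?thesis
      unfolding m_pow_R_powi_1 m_pow_R_powi_2[OF t] e_def[symmetric] D_eq sg.mult sx .
  qed
  have S: "?S = {mat22 a (x * (m_pow_R / D)) (e * m * sg (x * m_pow_R) * D) a | a x.
      a \<in> subfld q \<and> x \<in> subfld (q ^ 2) \<and> sg x + x = 0}"
  proof (intro Collect_cong iff_exI)
    fix A a x
    have b: "m powi R_exp q t s / (h ^ (q ^ s) + h ^ (q ^ (s * (t - 1)))) = m_pow_R / D"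
      unfolding m_pow_R_def D_eq ..
    show "(A = mat22 a (x * (m powi R_exp q t s / (h ^ (q ^ s) + h ^ (q ^ (s * (t - 1))))))
         (- x * rel_norm q t h * (m powi (R_exp q t s * int q ^ s + 1) * h ^ (q ^ s)
           + m powi (int q ^ (s * (t - 1)) * (R_exp q t s + 1)) * h ^ (q ^ (s * (t - 1))))) a \<and>
         a \<in> subfld q \<and> x \<in> subfld (q ^ 2) \<and> x ^ (q ^ s) + x = 0)
       \<longleftrightarrow> (A = mat22 a (x * (m_pow_R / D)) (e * m * sg (x * m_pow_R) * D) a \<and>
         a \<in> subfld q \<and> x \<in> subfld (q ^ 2) \<and> sg x + x = 0)"
    proof (cases "x ^ (q ^ s) + x = 0")
      case True
      show ?thesis unfolding c[OF True] b sg_def[of x] by (rule refl)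
    next
      case False
      then show ?thesis unfolding sg_def[of x] by (simp only: simp_thms)
    qed
  qed
  show ?thesis unfolding S
  proof (intro equalityI subsetI)
    fix A assume A: "A \<in> stab0 (psi q t m h s)"
    obtain a b c d where abcd: "A = mat22 a b c d" by (rule mat22_cases)
    from A have *: "a \<in> subfld q" "d = a" "stab_offset (b * D)" "c = e * m * sg (b * D) * D"
      unfolding abcd stab0_odd_iff[OF t] by auto
    from *(3) obtain x where x: "x \<in> subfld (q ^ 2)" "sg x + x = 0" "b * D = x * m_pow_R"
      unfolding stab_offset_odd_iff[OF t] by blast
    have "b = x * (m_pow_R / D)" using x(3) D_nonzero by (simp add: field_simps)
    then show "A \<in> {mat22 a (x * (m_pow_R / D)) (e * m * sg (x * m_pow_R) * D) a | a x.
      a \<in> subfld q \<and> x \<in> subfld (q ^ 2) \<and> sg x + x = 0}"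
      using * x abcd unfolding mem_Collect_eq by (intro exI[of _ a] exI[of _ x]) simp
  next
    fix A :: "'a^2^2" assume "A \<in> {mat22 a (x * (m_pow_R / D)) (e * m * sg (x * m_pow_R) * D) a | a x.
      a \<in> subfld q \<and> x \<in> subfld (q ^ 2) \<and> sg x + x = 0}"
    then obtain a x where ax: "A = mat22 a (x * (m_pow_R / D)) (e * m * sg (x * m_pow_R) * D) a"
      "a \<in> subfld q" "x \<in> subfld (q ^ 2)" "sg x + x = 0" by blast
    have "x * (m_pow_R / D) * D = x * m_pow_R" using D_nonzero by simp
    then show "A \<in> stab0 (psi q t m h s)"
      unfolding ax(1) stab0_odd_iff[OF t] using ax stab_offset_odd_iff[OF t, of "x * m_pow_R"] by auto
  qed
qed

end

section \<open>The right idealizer\<close>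

lemma pcompose_monom: "pcompose (monom c k) g = smult c (g ^ k)" for c :: "'a::comm_ring_1"
  by (induction k) (simp_all add: monom_0 monom_Suc pcompose_pCons)

lemma smult_sum_right: "smult c (\<Sum>i\<in>A. f i) = (\<Sum>i\<in>A. smult c (f i))"
  by (induction A rule: infinite_finite_induct) (simp_all add: smult_add_right)

lemma lin_polys_add:
  assumes "f \<in> lin_polys n q s" and "g \<in> lin_polys n q s"
  shows "f + g \<in> lin_polys n q s"
proof -
  obtain a b where "f = (\<Sum>i<n. monom (a i) (q ^ (s * i)))" "g = (\<Sum>i<n. monom (b i) (q ^ (s * i)))"
    using assms unfolding lin_polys_def by blast
  then have "f + g = (\<Sum>i<n. monom (a i + b i) (q ^ (s * i)))"
    by (simp add: sum.distrib flip: add_monom)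
  then show ?thesis unfolding lin_polys_def mem_Collect_eq by (intro exI[of _ "\<lambda>i. a i + b i"] conjI TrueI)
qed

lemma lin_polys_smult:
  assumes "f \<in> lin_polys n q s"
  shows "smult c f \<in> lin_polys n q s"
proof -
  obtain a where "f = (\<Sum>i<n. monom (a i) (q ^ (s * i)))"
    using assms unfolding lin_polys_def by blast
  then have "smult c f = (\<Sum>i<n. monom (c * a i) (q ^ (s * i)))"
    by (simp add: smult_sum_right smult_monom)
  then show ?thesis unfolding lin_polys_def mem_Collect_eq by (intro exI[of _ "\<lambda>i. c * a i"] conjI TrueI)
qed

lemma lin_polys_monom:
  assumes "i < n"
  shows "monom c (q ^ (s * i)) \<in> lin_polys n q s"
proof -
  have "(\<Sum>j<n. monom (if j = i then c else 0) (q ^ (s * j)))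
      = (\<Sum>j<n. if j = i then monom c (q ^ (s * i)) else 0)"
    by (intro sum.cong) auto
  also have "\<dots> = monom c (q ^ (s * i))" using assms by simp
  finally show ?thesis unfolding lin_polys_def mem_Collect_eq
    by (intro exI[of _ "\<lambda>j. if j = i then c else 0"] conjI TrueI) simp
qed

context galois_field
begin

abbreviation modulus :: "'a poly" where
  "modulus \<equiv> monom 1 (q ^ (s * (2 * t))) - monom 1 1"

lemma s_pos: "s > 0"
  using odd_s by (cases s) auto

lemma poly_modulus: "poly modulus x = 0"
proof -
  have "x ^ (q ^ (s * (2 * t))) = x ^ (q ^ 0)" by (rule frobenius_mod) simp
  then show ?thesis by (simp add: poly_monom)
qed

lemma poly_lin_comp:
  fixes x :: 'a
  shows "poly (lin_comp (2 * t) q s f g) x = poly f (poly g x)"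
proof -
  have "poly (pcompose f g) x
      = poly (pcompose f g div modulus * modulus + pcompose f g mod modulus) x"
    by (simp only: div_mult_mod_eq)
  also have "\<dots> = poly (pcompose f g mod modulus) x"
    by (simp only: poly_add poly_mult poly_modulus mult_zero_right add_0_left)
  finally show ?thesis unfolding lin_comp_def by (simp add: poly_pcompose)
qed

lemma lin_polys_eqI:
  assumes "f \<in> lin_polys (2 * t) q s" and "g \<in> lin_polys (2 * t) q s"
    and eq: "\<And>x::'a. poly f x = poly g x"
  shows "f = g"
proof -
  obtain a b where f: "f = (\<Sum>i<2*t. monom (a i) (q ^ (s * i)))"
    and g: "g = (\<Sum>i<2*t. monom (b i) (q ^ (s * i)))"
    using assms unfolding lin_polys_def by blast
  define L where "L = map (\<lambda>i. (a i - b i, i)) [0..<2*t]"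
  have "(\<Sum>(c, i)\<leftarrow>L. c * x ^ (q ^ (s * i))) = 0" for x
  proof -
    have "(\<Sum>(c, i)\<leftarrow>L. c * x ^ (q ^ (s * i))) = (\<Sum>i<2*t. (a i - b i) * x ^ (q ^ (s * i)))"
      unfolding L_def by (simp add: o_def interv_sum_list_conv_sum_set_nat atLeast0LessThan)
    also have "\<dots> = poly f x - poly g x"
      unfolding f g by (simp add: poly_sum poly_monom sum_subtractf left_diff_distrib)
    finally show ?thesis using eq by simp
  qed
  moreover have "distinct (map snd L)" "snd ` set L \<subseteq> {..<2 * t}"
    unfolding L_def by (auto simp: o_def)
  ultimately have "c = 0" if "(c, i) \<in> set L" for c i
    using frobenius_powers_independent that by blast
  then have "a i = b i" if "i < 2 * t" for i
    using that unfolding L_def by fastforce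
  then show ?thesis unfolding f g by (intro sum.cong) auto
qed

text \<open>Closure of linearized polynomials under reduced composition is proved by congruences, so that no
  quotient has to be computed: a linearized representative has smaller degree than the modulus, so
  it is the remainder.\<close>

definition reducible_to_lin :: "'a poly \<Rightarrow> bool" where
  "reducible_to_lin p \<longleftrightarrow> (\<exists>r\<in>lin_polys (2 * t) q s. modulus dvd p - r)"

lemma reducible_add:
  assumes "reducible_to_lin p" and "reducible_to_lin p'"
  shows "reducible_to_lin (p + p')"
proof -
  obtain r r' where r: "r \<in> lin_polys (2 * t) q s" "modulus dvd p - r"
    and r': "r' \<in> lin_polys (2 * t) q s" "modulus dvd p' - r'"
    using assms unfolding reducible_to_lin_def by blast
  have "p + p' - (r + r') = (p - r) + (p' - r')" by simp
  then have "modulus dvd p + p' - (r + r')" using dvd_add[OF r(2) r'(2)] by (simp only:)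
  then show ?thesis unfolding reducible_to_lin_def using lin_polys_add[OF r(1) r'(1)] by blast
qed

lemma reducible_sum:
  assumes "\<And>i. i \<in> I \<Longrightarrow> reducible_to_lin (F i)" and "finite I"
  shows "reducible_to_lin (\<Sum>i\<in>I. F i)"
  using assms(2,1)
proof (induction I rule: finite_induct)
  case empty
  have "0 \<in> lin_polys (2 * t) q s"
    using lin_polys_monom[of 0 "2 * t" 0] t5 by simp
  then show ?case unfolding reducible_to_lin_def by force
qed (simp add: reducible_add)

text \<open>\<open>X ^ (q ^ (s (2 t + j)))\<close> and \<open>X ^ (q ^ (s j))\<close> differ by the \<open>q ^ (s j)\<close>-th power of the modulus, by
  additivity of the Frobenius map.\<close>

lemma reducible_monom: "reducible_to_lin (monom c (q ^ (s * k)))"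
proof (induction k rule: less_induct)
  case (less k)
  show ?case
  proof (cases "k < 2 * t")
    case True
    then show ?thesis unfolding reducible_to_lin_def
      by (intro bexI[OF _ lin_polys_monom[OF True, of c]]) simp
  next
    case False
    define j where "j = k - 2 * t"
    have j: "k = 2 * t + j" "j < k" using False t5 by (auto simp: j_def)
    from less[OF j(2)] obtain r where r: "r \<in> lin_polys (2 * t) q s"
      "modulus dvd monom c (q ^ (s * j)) - r" unfolding reducible_to_lin_def by blast
    have "smult c (modulus ^ (q ^ (s * j))) = monom c (q ^ (s * k)) - monom c (q ^ (s * j))"
      unfolding frobenius_diff_poly monom_power j(1)
      by (simp add: smult_diff_right smult_monom power_add distrib_left)
    moreover have "modulus dvd smult c (modulus ^ (q ^ (s * j)))"
      by (intro dvd_smult dvd_power) (use q_gt_1 in simp)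
    ultimately have "modulus dvd monom c (q ^ (s * k)) - monom c (q ^ (s * j))" by (simp only:)
    from dvd_add[OF this r(2)] have "modulus dvd monom c (q ^ (s * k)) - r" by simp
    then show ?thesis unfolding reducible_to_lin_def using r(1) by blast
  qed
qed

lemma reducible_mod:
  assumes "reducible_to_lin p"
  shows "p mod modulus \<in> lin_polys (2 * t) q s"
proof -
  obtain r where r: "r \<in> lin_polys (2 * t) q s" "modulus dvd p - r"
    using assms unfolding reducible_to_lin_def by blast
  obtain a where a: "r = (\<Sum>i<2*t. monom (a i) (q ^ (s * i)))"
    using r(1) unfolding lin_polys_def by blast
  have "degree r \<le> q ^ (s * (2 * t - 1))"
    unfolding a
  proof (rule degree_sum_le)
    fix i assume "i \<in> {..<2 * t}"
    then have "s * i \<le> s * (2 * t - 1)" by (intro mult_le_mono2) auto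
    then have "q ^ (s * i) \<le> q ^ (s * (2 * t - 1))" using q_gt_1 by (intro power_increasing) auto
    then show "degree (monom (a i) (q ^ (s * i))) \<le> q ^ (s * (2 * t - 1))"
      using degree_monom_le order_trans by blast
  qed simp
  also have "\<dots> < q ^ (s * (2 * t))"
    using q_gt_1 s_pos t5 by (intro power_strict_increasing mult_less_mono2) auto
  also have "\<dots> \<le> degree modulus"
  proof (rule le_degree)
    have "q ^ (s * (2 * t)) > 1" using q_gt_1 s_pos t5 by (intro one_less_power) auto
    then show "coeff modulus (q ^ (s * (2 * t))) \<noteq> 0" by simp
  qed
  finally have "r mod modulus = r" by (rule mod_poly_less)
  moreover have "p mod modulus = r mod modulus" using r(2) by (simp only: mod_eq_dvd_iff)
  ultimately show ?thesis using r(1) by simp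
qed

lemma lin_comp_closed:
  assumes "f \<in> lin_polys (2 * t) q s" and "g \<in> lin_polys (2 * t) q s"
  shows "lin_comp (2 * t) q s f (g :: 'a poly) \<in> lin_polys (2 * t) q s"
proof -
  obtain a b where f: "f = (\<Sum>i<2*t. monom (a i) (q ^ (s * i)))"
    and g: "g = (\<Sum>i<2*t. monom (b i) (q ^ (s * i)))"
    using assms unfolding lin_polys_def by blast
  have "pcompose f g = (\<Sum>i<2*t. \<Sum>j<2*t. monom (a i * b j ^ (q ^ (s * i))) (q ^ (s * (j + i))))"
    unfolding f pcompose_sum pcompose_monom
    unfolding g frobenius_sum_poly monom_power smult_sum_right smult_monom
    by (simp only: power_add distrib_left)
  also have "reducible_to_lin \<dots>" by (intro reducible_sum reducible_monom) auto
  finally show ?thesis unfolding lin_comp_def by (rule reducible_mod)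
qed

lemma sg_two [simp]: "sg 2 = 2"
  using sg.add[of 1 1] by simp

lemma square_root_exists:
  fixes x :: 'a
  assumes "x \<in> subfld q"
  obtains z where "z * z = x"
proof (cases "x = 0")
  case False
  obtain f where f: "CARD('a) - 1 = (q ^ 2 - 1) * f" by (rule card_minus_one)
  obtain j where j: "q = 2 * j + 1" using odd_q by (elim oddE)
  have "2 * ((q - 1) * ((j + 1) * f)) = CARD('a) - 1"
    unfolding f by (simp add: j power2_eq_square algebra_simps)
  moreover have "x ^ ((q - 1) * ((j + 1) * f)) = 1"
    by (simp only: power_mult subfld_q_power_minus_one[OF assms False] power_one)
  ultimately obtain z where "z ^ 2 = x" by (rule power_eq_one_imp_power_residue)
  then show ?thesis using that by (simp add: power2_eq_square)
qed (use that in simp)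

text \<open>Solutions of \<open>x ^ (q - 1) = -1\<close> exist by the count of power residues, and \<open>\<sigma>\<close> agrees with
  \<open>x \<mapsto> x ^ q\<close> on the subfield of order \<open>q\<^sup>2\<close> because \<open>s\<close> is odd.\<close>

lemma anti_fixed_exists:
  obtains x where "x \<noteq> 0" and "x \<in> subfld (q ^ 2)" and "sg x = - x"
proof -
  obtain f where f: "CARD('a) - 1 = (q ^ 2 - 1) * f" by (rule card_minus_one)
  have q2: "q ^ 2 - 1 = (q - 1) * (q + 1)"
    using q_gt_1 by (cases q) (auto simp: power2_eq_square)
  have "(q - 1) * ((q + 1) * f) = CARD('a) - 1" unfolding f q2 by (simp only: mult.assoc)
  moreover have "(- 1 :: 'a) ^ ((q + 1) * f) = 1" using odd_q by simp
  ultimately obtain x :: 'a where x: "x ^ (q - 1) = - 1" by (rule power_eq_one_imp_power_residue)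
  have "x ^ q = x ^ (q - 1) * x" using q_gt_1 by (simp flip: power_Suc2)
  then have xq: "x ^ q = - x" using x by simp
  have "x ^ (q ^ 2) = (x ^ q) ^ q" by (simp add: power2_eq_square power_mult)
  also have "\<dots> = x" unfolding xq using odd_q xq by simp
  finally have x2: "x \<in> subfld (q ^ 2)" by (simp add: subfld_def)
  have "sg x = - x" unfolding sg_def subfld_square_odd_power[OF x2 odd_s] by (rule xq)
  moreover have "x \<noteq> 0" using x q_gt_1 by (auto simp: power_0_left)
  ultimately show ?thesis using x2 that by blast
qed

end

context psi_field
begin

definition code_elem :: "'a \<Rightarrow> 'a \<Rightarrow> 'a poly" where
  "code_elem a b = monom a 1 + smult b (psi q t m h s)"

lemma poly_code_elem: "poly (code_elem a b) x = a * x + b * psi_map x"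
  by (simp add: code_elem_def poly_monom poly_psi)

lemma code_eq: "code (psi q t m h s) = {code_elem a b | a b. True}"
  unfolding code_def code_elem_def ..

lemma code_elem_lin_polys: "code_elem a b \<in> lin_polys (2 * t) q s"
proof -
  have X: "monom c (q ^ (s * i)) \<in> lin_polys (2 * t) q s" if "i < 2 * t" for c :: 'a and i
    using that by (rule lin_polys_monom)
  have "psi q t m h s = monom m (q ^ (s * 1))
     + monom (- m * (h powi (1 - int q ^ (s * (t + 1))))) (q ^ (s * (t + 1)))
     + monom 1 (q ^ (s * (t - 1)))
     + monom (h powi (1 - int q ^ (s * (2 * t - 1)))) (q ^ (s * (2 * t - 1)))"
    unfolding psi_def by (simp add: smult_diff_right smult_monom minus_monom[symmetric])
  also have "\<dots> \<in> lin_polys (2 * t) q s"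
    using t5 by (intro lin_polys_add X) auto
  finally have "psi q t m h s \<in> lin_polys (2 * t) q s" .
  moreover have "monom a 1 \<in> lin_polys (2 * t) q s" using X[of 0 a] t5 by simp
  ultimately show ?thesis unfolding code_elem_def by (intro lin_polys_add lin_polys_smult)
qed

lemma coeff_code_elem: "coeff (code_elem a b) 1 = a" "coeff (code_elem a b) (q ^ s) = b * m"
proof -
  have p: "q ^ k \<noteq> 1" if "k > 0" for k using one_less_power[OF q_gt_1 that] by (metis less_irrefl)
  have inj: "q ^ i = q ^ j \<longleftrightarrow> i = j" for i j using q_gt_1 by simp
  have "s * (t + 1) > 0" "s * (t - 1) > 0" "s * (2 * t - 1) > 0" using s_pos t5 by auto
  then show "coeff (code_elem a b) 1 = a"
    unfolding code_elem_def psi_def using p[OF s_pos] p[of "s * (t + 1)"] p[of "s * (t - 1)"] p[of "s * (2 * t - 1)"]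
    by (simp only: coeff_add coeff_smult coeff_diff coeff_monom if_False simp_thms) simp
  have "s * (t + 1) \<noteq> s" "s * (t - 1) \<noteq> s" "s * (2 * t - 1) \<noteq> s" using s_pos t5 by auto
  then show "coeff (code_elem a b) (q ^ s) = b * m"
    unfolding code_elem_def psi_def using p[OF s_pos]
    by (simp only: coeff_add coeff_smult coeff_diff coeff_monom inj if_False simp_thms not_sym) simp
qed

lemma code_elem_one: "code_elem 1 0 = monom 1 1"
  by (simp add: code_elem_def)

text \<open>Composition is multiplication of first rows: the second factor acts on \<open>(x, \<psi>(x))\<close> by its
  matrix.\<close>

lemma lin_comp_code_elem:
  assumes "a \<in> subfld (if even t then q ^ 2 else q)" and "stab_offset (b * D)"
  shows "lin_comp (2 * t) q s (code_elem a' b') (code_elem a b)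
    = code_elem (a' * a + b' * (e * m * sg (b * D) * D)) (a' * b + b' * sg a)"
proof (rule lin_polys_eqI)
  fix x
  have "psi_map (a * x + b * psi_map x) = e * m * sg (b * D) * D * x + sg a * psi_map x"
    using preserves_graph_iff[of a b "e * m * sg (b * D) * D" "sg a"] assms diagonal_fixed_iff[of a]
    by blast
  then show "poly (lin_comp (2 * t) q s (code_elem a' b') (code_elem a b)) x
      = poly (code_elem (a' * a + b' * (e * m * sg (b * D) * D)) (a' * b + b' * sg a)) x"
    unfolding poly_lin_comp poly_code_elem by (simp only: algebra_simps)
qed (intro lin_comp_closed code_elem_lin_polys, rule code_elem_lin_polys)

text \<open>Composing \<open>X\<close> with \<open>g\<close> puts \<open>g\<close> itself into the code, and composing \<open>\<psi>\<close> with \<open>g\<close> supplies the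
  second row of a matrix that preserves the graph.\<close>

lemma right_idealizer_eq:
  "right_idealizer (2 * t) q s (code (psi q t m h s)) =
    {code_elem a b | a b. a \<in> subfld (if even t then q ^ 2 else q) \<and> stab_offset (b * D)}" (is "?I = ?S")
proof (intro equalityI subsetI)
  fix g assume g: "g \<in> ?I"
  then have gl: "g \<in> lin_polys (2 * t) q s"
    and gC: "\<And>a b. lin_comp (2 * t) q s (code_elem a b) g \<in> code (psi q t m h s)"
    unfolding right_idealizer_def code_eq by blast+
  have "lin_comp (2 * t) q s (code_elem 1 0) g = g"
    by (rule lin_polys_eqI) (auto intro: lin_comp_closed code_elem_lin_polys gl simp: poly_lin_comp poly_code_elem)
  then obtain a b where ab: "g = code_elem a b" using gC[of 1 0] unfolding code_eq by auto
  obtain c d where cd: "lin_comp (2 * t) q s (code_elem 0 1) g = code_elem c d"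
    using gC[of 0 1] unfolding code_eq by auto
  have "psi_map (a * x + b * psi_map x) = c * x + d * psi_map x" for x
    using arg_cong[OF cd, of "\<lambda>p. poly p x"] by (simp add: ab poly_lin_comp poly_code_elem)
  then have "bar a = a \<and> sg a = tau a \<and> d = sg a \<and> stab_offset (b * D) \<and> c = e * m * sg (b * D) * D"
    by (simp only: preserves_graph_iff[symmetric] simp_thms)
  then show "g \<in> ?S" unfolding ab using diagonal_fixed_iff[of a] by blast
next
  fix g assume "g \<in> ?S"
  then obtain a b where ab: "g = code_elem a b" "a \<in> subfld (if even t then q ^ 2 else q)" "stab_offset (b * D)"
    by blast
  show "g \<in> ?I"
    unfolding right_idealizer_def code_eq mem_Collect_eq ab(1)
  proof (intro conjI ballI)
    fix f assume "f \<in> {code_elem a b | a b. True}"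
    then obtain a' b' where f: "f = code_elem a' b'" by blast
    show "\<exists>a'' b''. lin_comp (2 * t) q s f (code_elem a b) = code_elem a'' b'' \<and> True"
      unfolding f lin_comp_code_elem[OF ab(2,3)] by blast
  qed (rule code_elem_lin_polys)
qed

lemma idealizer_iso_even:
  assumes t: "even t"
  shows "right_idealizer_ring (2 * t) q s (code (psi q t m h s)) \<simeq> (subfld_ring (q ^ 2) :: 'a ring)"
proof -
  have I: "right_idealizer (2 * t) q s (code (psi q t m h s)) = (\<lambda>a. code_elem a 0) ` subfld (q ^ 2)"
    unfolding right_idealizer_eq
    using t stab_offset_zero stab_offset_even[OF t] D_nonzero by fastforce
  have "(\<lambda>p. coeff p 1) \<in> ring_iso (right_idealizer_ring (2 * t) q s (code (psi q t m h s)))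
      (subfld_ring (q ^ 2) :: 'a ring)"
  proof (rule ring_iso_memI; (simp only: right_idealizer_ring_def subfld_ring_def ring.simps monoid.simps partial_object.simps I)?)
    fix p p' assume "p \<in> (\<lambda>a. code_elem a 0) ` subfld (q ^ 2)" "p' \<in> (\<lambda>a. code_elem a 0) ` subfld (q ^ 2)"
    then obtain a a' where "p = code_elem a 0" "p' = code_elem a' 0" "a' \<in> subfld (q ^ 2)" by blast
    then show "coeff (lin_comp (2 * t) q s p p') 1 = coeff p 1 * coeff p' 1"
      using lin_comp_code_elem[of a' 0 a 0] t stab_offset_zero by (simp add: coeff_code_elem[unfolded One_nat_def])
  next
    show "bij_betw (\<lambda>p. coeff p 1) ((\<lambda>a. code_elem a 0) ` subfld (q ^ 2)) (subfld (q ^ 2))"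
      by (rule bij_betwI[where g = "\<lambda>a. code_elem a 0"]) (auto simp: coeff_code_elem[unfolded One_nat_def])
  qed (auto simp: coeff_code_elem[unfolded One_nat_def])
  then show ?thesis unfolding is_ring_iso_def by blast
qed

text \<open>All \<open>b\<close> that occur are multiples \<open>r b0\<close> of a fixed nonzero one with \<open>r\<close> in the subfield of order \<open>q\<close>. The
  element \<open>b0 \<psi>\<close> squares to the nonsquare scalar \<open>e0\<close>, so sending it to a square root \<open>\<eta>\<close> of \<open>e0\<close> in
  the ambient field gives the isomorphism; \<open>\<sigma>(\<eta>) = - \<eta>\<close> recovers \<open>\<alpha>\<close> and \<open>r\<close> from \<open>\<alpha> + r \<eta>\<close>.\<close>

lemma idealizer_iso_odd:
  assumes t: "odd t"
  shows "right_idealizer_ring (2 * t) q s (code (psi q t m h s)) \<simeq> (subfld_ring (q ^ 2) :: 'a ring)"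
proof -
  obtain x0 where x0: "x0 \<noteq> 0" "x0 \<in> subfld (q ^ 2)" "sg x0 = - x0"
    by (rule anti_fixed_exists)
  define y0 where "y0 = x0 * m_pow_R"
  define b0 where "b0 = y0 / D"
  define e0 where "e0 = e * (m * y0 * sg y0)"
  have y0: "stab_offset y0" "y0 \<noteq> 0"
    unfolding stab_offset_odd_iff[OF t] using x0 by (auto simp: y0_def)
  have b0: "b0 \<noteq> 0" "b0 * D = y0" using y0 D_nonzero by (auto simp: b0_def)
  have offset: "stab_offset (b * D) \<longleftrightarrow> (\<exists>r\<in>subfld q. b = r * b0)" for b
  proof
    assume "stab_offset (b * D)"
    then obtain x where x: "x \<in> subfld (q ^ 2)" "sg x + x = 0" "b * D = x * m_pow_R"
      unfolding stab_offset_odd_iff[OF t] by blast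
    have "sg x = - x" using x(2) by (simp add: eq_neg_iff_add_eq_0)
    then have "sg (x / x0) = x / x0" using x0 by simp
    then have "x / x0 \<in> subfld q" by (simp only: sg_fixed_iff)
    moreover have "b = x / x0 * b0" using x(3) D_nonzero x0 by (simp add: b0_def y0_def field_simps)
    ultimately show "\<exists>r\<in>subfld q. b = r * b0" by blast
  next
    assume "\<exists>r\<in>subfld q. b = r * b0"
    then obtain r where r: "r \<in> subfld q" "b = r * b0" by blast
    have sr: "sg r = r" using r(1) by (simp only: sg_fixed_iff)
    have "r * x0 \<in> subfld (q ^ 2)" unfolding sg_sg_fixed_iff[symmetric] using x0 sr by simp
    moreover have "sg (r * x0) + r * x0 = 0" using x0 sr by simp
    moreover have "b * D = (r * x0) * m_pow_R" using r(2) b0(2) by (simp add: y0_def mult_ac)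
    ultimately show "stab_offset (b * D)" unfolding stab_offset_odd_iff[OF t] by blast
  qed
  have "sg e0 = e0"
    using stab_offset_lambda[OF y0(1)] unfolding e0_def sg_fixed_iff[symmetric] by simp
  then have e0: "e0 \<in> subfld q" by (simp only: sg_fixed_iff)
  then obtain \<eta> where \<eta>: "\<eta> * \<eta> = e0" by (rule square_root_exists)
  have \<eta>q: "\<eta> \<notin> subfld q"
    using stab_offset_nonsquare[OF t y0, of \<eta>] \<eta> by (auto simp: e0_def)
  then have "sg \<eta> \<noteq> \<eta>" by (simp add: sg_fixed_iff)
  moreover have "sg \<eta> * sg \<eta> = \<eta> * \<eta>" using \<eta> \<open>sg e0 = e0\<close> by (metis sg.mult)
  ultimately have s\<eta>: "sg \<eta> = - \<eta>" by (simp add: square_eq_iff)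
  have \<eta>0: "\<eta> \<noteq> 0" using s\<eta> \<open>sg \<eta> \<noteq> \<eta>\<close> by auto
  define F where "F a r = code_elem a (r * b0)" for a r
  define \<phi> where "\<phi> p = coeff p 1 + coeff p (q ^ s) / (m * b0) * \<eta>" for p
  have \<phi>F: "\<phi> (F a r) = a + r * \<eta>" for a r
    unfolding \<phi>_def F_def coeff_code_elem using b0(1) by simp
  define G where "G z = F ((z + sg z) / 2) ((z - sg z) / (2 * \<eta>))" for z
  let ?I = "{F a r | a r. a \<in> subfld q \<and> r \<in> subfld q}"
  have I: "right_idealizer (2 * t) q s (code (psi q t m h s)) = ?I"
    unfolding right_idealizer_eq F_def offset using t by (simp only: if_False) blast
  have comp: "lin_comp (2 * t) q s (F a r) (F a' r') = F (a * a' + r * r' * e0) (a * r' + r * a')"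
    if "a' \<in> subfld q" "r' \<in> subfld q" for a r a' r'
  proof -
    have sr: "sg a' = a'" "sg r' = r'" using that by (simp_all only: sg_fixed_iff)
    have o: "stab_offset (r' * b0 * D)" using offset that(2) by blast
    have y: "r' * b0 * D = r' * y0" using b0(2) by (simp add: mult.assoc)
    have "a' \<in> subfld (if even t then q ^ 2 else q)" using that(1) t by simp
    from lin_comp_code_elem[OF this o, of a "r * b0"]
    have "lin_comp (2 * t) q s (F a r) (F a' r')
      = code_elem (a * a' + r * b0 * (e * m * sg (r' * y0) * D)) (a * (r' * b0) + r * b0 * a')"
      unfolding F_def y sr .
    also have "r * b0 * (e * m * sg (r' * y0) * D) = r * r' * (e * m * sg y0 * (b0 * D))"
      by (simp add: sr mult_ac)
    also have "\<dots> = r * r' * e0" unfolding b0(2) e0_def by (simp add: mult_ac)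
    also have "a * (r' * b0) + r * b0 * a' = (a * r' + r * a') * b0" by (simp add: algebra_simps)
    finally show ?thesis unfolding F_def .
  qed
  have \<phi>_mem: "a + r * \<eta> \<in> subfld (q ^ 2)" and G\<phi>: "G (a + r * \<eta>) = F a r"
    if "a \<in> subfld q" "r \<in> subfld q" for a r
  proof -
    have sr: "sg a = a" "sg r = r" using that by (simp_all only: sg_fixed_iff)
    have sz: "sg (a + r * \<eta>) = a - r * \<eta>" by (simp add: sr s\<eta>)
    have "sg (sg (a + r * \<eta>)) = a + r * \<eta>" by (simp add: sr s\<eta>)
    then show "a + r * \<eta> \<in> subfld (q ^ 2)" by (simp only: sg_sg_fixed_iff)
    have "(a + r * \<eta> + (a - r * \<eta>)) / 2 = a" using two_ne_zero by (simp add: field_simps)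
    moreover have "(a + r * \<eta> - (a - r * \<eta>)) / (2 * \<eta>) = r"
      using two_ne_zero \<eta>0 by (simp add: field_simps)
    ultimately show "G (a + r * \<eta>) = F a r" unfolding G_def sz by simp
  qed
  have G_mem: "G z \<in> ?I" and \<phi>G: "\<phi> (G z) = z" if "z \<in> subfld (q ^ 2)" for z
  proof -
    have sz: "sg (sg z) = z" using that by (simp only: sg_sg_fixed_iff)
    have "sg ((z + sg z) / 2) = (z + sg z) / 2" by (simp add: sz add.commute)
    moreover have "sg ((z - sg z) / (2 * \<eta>)) = (z - sg z) / (2 * \<eta>)"
      by (simp add: sz s\<eta> minus_divide_right[symmetric] minus_divide_left)
    ultimately have "(z + sg z) / 2 \<in> subfld q" "(z - sg z) / (2 * \<eta>) \<in> subfld q"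
      by (simp_all only: sg_fixed_iff)
    then show "G z \<in> ?I" unfolding G_def by blast
    have "(z - sg z) / (2 * \<eta>) * \<eta> = (z - sg z) / 2" using \<eta>0 by simp
    then have "(z + sg z) / 2 + (z - sg z) / (2 * \<eta>) * \<eta> = ((z + sg z) + (z - sg z)) / 2"
      by (simp only: add_divide_distrib)
    also have "\<dots> = 2 * z / 2" by simp
    finally have "(z + sg z) / 2 + (z - sg z) / (2 * \<eta>) * \<eta> = z" using two_ne_zero by simp
    then show "\<phi> (G z) = z" unfolding G_def \<phi>F .
  qed
  have "\<phi> \<in> ring_iso (right_idealizer_ring (2 * t) q s (code (psi q t m h s)))
      (subfld_ring (q ^ 2) :: 'a ring)"
  proof (rule ring_iso_memI; (simp only: right_idealizer_ring_def subfld_ring_def ring.simps monoid.simps partial_object.simps I)?)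
    fix p assume "p \<in> ?I"
    then show "\<phi> p \<in> subfld (q ^ 2)" using \<phi>F \<phi>_mem by force
  next
    fix p p' assume "p \<in> ?I" "p' \<in> ?I"
    then obtain a r a' r' where p: "p = F a r" "p' = F a' r'" "a' \<in> subfld q" "r' \<in> subfld q" by blast
    show "\<phi> (lin_comp (2 * t) q s p p') = \<phi> p * \<phi> p'"
      unfolding p(1,2) comp[OF p(3,4)] \<phi>F \<eta>[symmetric] by (simp add: algebra_simps)
    show "\<phi> (p + p') = \<phi> p + \<phi> p'"
      unfolding \<phi>_def by (simp add: add_divide_distrib algebra_simps)
  next
    have "monom 1 1 = F 1 0" by (simp add: F_def code_elem_one[unfolded One_nat_def])
    then show "\<phi> (monom 1 1) = 1" using \<phi>F[of 1 0] by simp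
  next
    show "bij_betw \<phi> ?I (subfld (q ^ 2))"
    proof (rule bij_betwI[where g = G])
      show "\<phi> \<in> ?I \<rightarrow> subfld (q ^ 2)" using \<phi>F \<phi>_mem by force
      show "G \<in> subfld (q ^ 2) \<rightarrow> ?I" using G_mem by blast
      show "G (\<phi> p) = p" if "p \<in> ?I" for p using that \<phi>F G\<phi> by force
    qed (rule \<phi>G)
  qed
  then show ?thesis unfolding is_ring_iso_def by blast
qed

end

theorem theorem5p3:
  fixes q t s :: nat and m h :: "'a::{field,finite}"
  assumes "primepow q" and "odd q"
    and "t \<ge> 5"
    and "1 \<le> s" and "s \<le> 2 * t - 1" and "coprime s (2 * t)"
    and "CARD('a) = q ^ (2 * t)"
    and "admissible q t s m h"
  shows
    "(even t \<longrightarrow>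
        stab0 (psi q t m h s) = {mat22 \<alpha> 0 0 (\<alpha> ^ (q ^ s)) | \<alpha>. \<alpha> \<in> subfld (q ^ 2)}) \<and>
     (odd t \<longrightarrow>
        stab0 (psi q t m h s) =
          {mat22 \<alpha>
                 (\<xi> * (m powi R_exp q t s / (h ^ (q ^ s) + h ^ (q ^ (s * (t - 1))))))
                 (- \<xi> * rel_norm q t h *
                    (m powi (R_exp q t s * int q ^ s + 1) * h ^ (q ^ s)
                     + m powi (int q ^ (s * (t - 1)) * (R_exp q t s + 1))
                         * h ^ (q ^ (s * (t - 1)))))
                 \<alpha>
           | \<alpha> \<xi>. \<alpha> \<in> subfld q \<and> \<xi> \<in> subfld (q ^ 2) \<and> \<xi> ^ (q ^ s) + \<xi> = 0}) \<and>
     right_idealizer_ring (2 * t) q s (code (psi q t m h s))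
       \<simeq> (subfld_ring (q ^ 2) :: 'a ring)"
proof -
  interpret psi_field q t s "TYPE('a)" m h
    by unfold_locales (use assms in auto)
  show ?thesis
    using stab0_even stab0_odd idealizer_iso_even idealizer_iso_odd by blast
qed

end
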